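(* Let $n\ge1$ and let $f_1,\dots,f_n$ be transcendental entire functions on $\mathbb{C}$ of finite order satisfying $T(r,f_i)=S(r,f_{i+1})$ for $1\le i\le n-1$. Then for every transcendental entire function $F$ on $\mathbb{C}$ of positive order, $$\mathrm{tr.deg}_{\mathbb{C}}\,\mathbb{C}\big(f_1,\dots,f_n,F(f_1),\dots,F(f_n)\big)=2n .$$
   Context: For a meromorphic function $f$ on $\mathbb{C}$, $T(r,f)$ is the Nevanlinna characteristic; $S(r,f)$ denotes any quantity that is $o(T(r,f))$ as $r\to\infty$ outside a possible exceptional set of $r$ of finite linear measure. The order of $f$ is $\rho(f)=\limsup_{r\to\infty}\frac{\log T(r,f)}{\log r}$; finite order means $\rho(f)<\infty$, positive order means $\rho(f)>0$. $F(f_i)=F\circ f_i$. $\mathrm{tr.deg}_{\mathbb{C}}\,\mathbb{C}(g_1,\dots,g_k)$ is the transcendence degree over $\mathbb{C}$ of the field generated over $\mathbb{C}$ by $g_1,\dots,g_k$. *)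

theory Defs
  imports "HOL-Analysis.Analysis" "HOL-Library.Landau_Symbols" "HOL-Library.Extended_Nat"
begin

definition entire :: "(complex \<Rightarrow> complex) \<Rightarrow> bool" where
  "entire f \<longleftrightarrow> f holomorphic_on UNIV"

definition transcendental_entire :: "(complex \<Rightarrow> complex) \<Rightarrow> bool" where
  "transcendental_entire f \<longleftrightarrow> entire f \<and> \<not> (\<exists>p. \<forall>z. f z = poly p z)"

section \<open>Nevanlinna characteristic (for entire functions, T(r,f) = m(r,f))\<close>

definition log_plus :: "real \<Rightarrow> real" where
  "log_plus x = (if x \<le> 1 then 0 else ln x)"

definition nev_T :: "(complex \<Rightarrow> complex) \<Rightarrow> real \<Rightarrow> real" where
  "nev_T f r = integral {0..2*pi} (\<lambda>t. log_plus (cmod (f (complex_of_real r * cis t)))) / (2*pi)"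

definition small_wrt :: "(real \<Rightarrow> real) \<Rightarrow> (complex \<Rightarrow> complex) \<Rightarrow> bool" where
  "small_wrt \<phi> f \<longleftrightarrow>
     (\<exists>E::real set. E \<in> lmeasurable \<and> \<phi> \<in> o[inf at_top (principal (- E))](nev_T f))"

definition nev_order :: "(complex \<Rightarrow> complex) \<Rightarrow> ereal" where
  "nev_order f = Limsup at_top (\<lambda>r. ereal (ln (nev_T f r) / ln r))"

text \<open>A polynomial in the variables X_0..X_{k-1} with complex coefficients is a finitely
  supported coefficient function on monomials (exponent vectors) supported on indices < k.\<close>
definition mpoly_ok :: "nat \<Rightarrow> ((nat \<Rightarrow> nat) \<Rightarrow> complex) \<Rightarrow> bool" where
  "mpoly_ok k c \<longleftrightarrow> finite {m. c m \<noteq> 0} \<and> (\<forall>m. c m \<noteq> 0 \<longrightarrow> (\<forall>i\<ge>k. m i = 0))"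

definition mpoly_eval ::
  "nat \<Rightarrow> ((nat \<Rightarrow> nat) \<Rightarrow> complex) \<Rightarrow> (nat \<Rightarrow> complex \<Rightarrow> complex) \<Rightarrow> complex \<Rightarrow> complex" where
  "mpoly_eval k c hs z = (\<Sum>m\<in>{m. c m \<noteq> 0}. c m * (\<Prod>i<k. hs i z ^ m i))"

definition alg_indep :: "nat \<Rightarrow> (nat \<Rightarrow> complex \<Rightarrow> complex) \<Rightarrow> bool" where
  "alg_indep m hs \<longleftrightarrow>
     (\<forall>c. mpoly_ok m c \<and> (\<forall>z. mpoly_eval m c hs z = 0) \<longrightarrow> (\<forall>mm. c mm = 0))"

definition gen_algebra :: "nat \<Rightarrow> (nat \<Rightarrow> complex \<Rightarrow> complex) \<Rightarrow> (complex \<Rightarrow> complex) set" where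
  "gen_algebra k gs = {(\<lambda>z. mpoly_eval k c gs z) | c. mpoly_ok k c}"

text \<open>Transcendence degree over C of C(g_0,...,g_{k-1}) = fraction field of C[g_0..g_{k-1}]:
  the supremum of the sizes of algebraically independent families of its elements
  (computed in the generated algebra, whose fraction field is the generated field).\<close>
definition trdeg :: "nat \<Rightarrow> (nat \<Rightarrow> complex \<Rightarrow> complex) \<Rightarrow> enat" where
  "trdeg k gs = Sup {enat m | m. \<exists>hs. (\<forall>i<m. hs i \<in> gen_algebra k gs) \<and> alg_indep m hs}"

end

theory Submission
  imports Defs "HOL-Complex_Analysis.Complex_Analysis"
begin

text \<open>
  If \<open>h\<close> satisfies a polynomial equation over \<open>\<complex>(g\<^sub>1, \<dots>, g\<^sub>k)\<close>, with the \<open>g\<^sub>i\<close> algebraically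
  independent, then Jensen's inequality for the leading coefficient gives
  \<open>T(r, h) \<le> C (1 + \<Sum> T(r, g\<^sub>i))\<close>. So it suffices to show that each function in the list
  \<open>f\<^sub>1, \<dots>, f\<^sub>n, F(f\<^sub>1), \<dots>, F(f\<^sub>n)\<close> violates such a bound with respect to its predecessors, at
  suitable arbitrarily large radii. For the \<open>f\<^sub>i\<close> this is the hypothesis. For \<open>F(f\<^sub>m)\<close>, Bohr's
  covering argument gives \<open>log M(2r, F(f\<^sub>m)) \<ge> log M(c M(r, f\<^sub>m), F)\<close>. Choosing \<open>r\<close> adapted to
  radii \<open>R\<close> with \<open>log M(R, F) \<ge> R\<^sup>\<delta>\<close> makes this larger than every power of \<open>r\<close>, hence larger than
  all \<open>T(r, f\<^sub>i)\<close>. Since \<open>R\<close> may be taken as any fixed power of the lower end \<open>s\<close> of the range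
  \<open>[s, s\<^sup>2]\<close> of admissible \<open>r\<close>, finite order leaves room to choose \<open>r\<close> with
  \<open>log M(32r, f\<^sub>m) \<le> K log M(r, f\<^sub>m)\<close>. There \<open>M(r, f\<^sub>i)\<close> is at most a small power of \<open>M(r, f\<^sub>m)\<close>
  for \<open>i < m\<close>, and the convexity of \<open>log M(\<cdot>, F)\<close> makes \<open>T(r, F(f\<^sub>i))\<close> a small multiple of
  \<open>T(r, F(f\<^sub>m))\<close>.
\<close>

section \<open>Circle means and the mean value inequality\<close>

definition circle_mean :: "(complex \<Rightarrow> real) \<Rightarrow> real \<Rightarrow> real" where
  "circle_mean u r = integral {0..2*pi} (\<lambda>t. u (complex_of_real r * cis t)) / (2*pi)"

lemma nev_T_eq_circle_mean: "nev_T f = circle_mean (\<lambda>z. log_plus (cmod (f z)))"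
  by (simp add: nev_T_def circle_mean_def fun_eq_iff)

lemma cis_add_2pi: "cis (t + 2*pi) = cis t"
  by (simp flip: cis_mult)

lemma integral_period:
  fixes H :: "real \<Rightarrow> real"
  assumes cont: "continuous_on UNIV H" and per: "\<And>t. H (t + p) = H t" and "0 \<le> p"
  shows "integral {a..a+p} H = integral {0..p} H"
proof -
  have int: "H integrable_on {c..d}" for c d
    by (intro integrable_continuous_interval continuous_on_subset[OF cont]) auto
  have sh: "integral {c+p..d+p} H = integral {c..d} H" for c d
    using integral_shift_Icc_real[of c d H p] per by (simp add: add.commute o_def)
  show ?thesis
  proof (cases "a \<ge> 0")
    case True
    have "integral {0..a} H + integral {a..a+p} H = integral {0..a+p} H"
      using True assms by (intro Henstock_Kurzweil_Integration.integral_combine int) auto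
    moreover have "integral {0..p} H + integral {p..a+p} H = integral {0..a+p} H"
      using True assms by (intro Henstock_Kurzweil_Integration.integral_combine int) auto
    ultimately show ?thesis using sh[of 0 a] by simp
  next
    case False
    have "integral {a..0} H + integral {0..p} H = integral {a..p} H"
      using False assms by (intro Henstock_Kurzweil_Integration.integral_combine int) auto
    moreover have "integral {a..a+p} H + integral {a+p..p} H = integral {a..p} H"
      using False assms by (intro Henstock_Kurzweil_Integration.integral_combine int) auto
    ultimately show ?thesis using sh[of a 0] by simp
  qed
qed

text \<open>Uniform continuity on the compact circle passes to the angle because \<open>cis\<close>
  is 1-Lipschitz.\<close>

lemma uniformly_continuous_circle:
  assumes cont: "continuous_on (sphere 0 R) h" and R: "R > 0" and e: "e > 0"
  obtains d where "d > 0"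
    "\<And>s t. \<bar>s - t\<bar> < d \<Longrightarrow> \<bar>h (complex_of_real R * cis s) - h (complex_of_real R * cis t)\<bar> < (e::real)"
proof -
  have "uniformly_continuous_on (sphere 0 R) h"
    by (rule compact_uniformly_continuous[OF cont]) simp
  then obtain d where d: "d > 0" "\<And>x y. x \<in> sphere 0 R \<Longrightarrow> y \<in> sphere 0 R \<Longrightarrow> dist y x < d \<Longrightarrow> dist (h y) (h x) < e"
    using e unfolding uniformly_continuous_on_def by metis
  have lip: "cmod (cis s - cis t) \<le> \<bar>s - t\<bar>" for s t
  proof -
    have "norm (cis s - cis t) \<le> 1 * norm (s - t)"
    proof (rule differentiable_bound[of UNIV cis "\<lambda>x h. h *\<^sub>R (\<i> * cis x)"])
      fix x :: real
      show "(cis has_derivative (\<lambda>h. h *\<^sub>R (\<i> * cis x))) (at x within UNIV)"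
        using has_derivative_cis[OF has_derivative_ident, of x] by simp
      show "onorm (\<lambda>h::real. h *\<^sub>R (\<i> * cis x)) \<le> 1"
        by (rule onorm_bound) (auto simp: norm_mult)
    qed auto
    then show ?thesis by simp
  qed
  show ?thesis
  proof
    show "d / R > 0" using d R by simp
    fix s t :: real assume st: "\<bar>s - t\<bar> < d / R"
    have "dist (complex_of_real R * cis s) (complex_of_real R * cis t) = R * cmod (cis s - cis t)"
      using R by (simp add: dist_norm norm_mult flip: right_diff_distrib)
    also have "\<dots> \<le> R * \<bar>s - t\<bar>" using lip R by simp
    also have "\<dots> < d" using st R by (simp add: field_simps)
    finally show "\<bar>h (complex_of_real R * cis s) - h (complex_of_real R * cis t)\<bar> < e"
      using d(2)[of "complex_of_real R * cis t" "complex_of_real R * cis s"] R by (simp add: dist_real_def norm_mult)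
  qed
qed

lemma continuous_on_circle:
  assumes "continuous_on (sphere 0 R) h" "R \<ge> 0"
  shows "continuous_on A (\<lambda>t. h (complex_of_real R * cis t))"
  by (rule continuous_on_compose2[OF assms(1)])
     (use assms(2) in \<open>auto intro!: continuous_intros simp: norm_mult\<close>)

text \<open>The product of \<open>f\<close> over the \<open>N\<close> rotations by roots of unity has value \<open>f 0 ^ N\<close> at the
  origin, while the logarithm of its modulus on the circle is bounded by a Riemann sum of the
  majorant; so no information on the zeros of \<open>f\<close> is needed.\<close>

lemma mean_value_majorant:
  fixes h :: "complex \<Rightarrow> real"
  assumes holf: "f holomorphic_on ball 0 R" and contf: "continuous_on (cball 0 R) f"
    and R: "R > 0" and conth: "continuous_on (sphere 0 R) h"
    and le: "\<And>z. cmod z = R \<Longrightarrow> cmod (f z) \<le> exp (h z)"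
  shows "cmod (f 0) \<le> exp (circle_mean h R)"
proof -
  define H where "H = (\<lambda>t. h (complex_of_real R * cis t))"
  have contH: "continuous_on A H" for A
    unfolding H_def using continuous_on_circle[OF conth] R by simp
  have intH: "H integrable_on {c..d}" for c d
    by (intro integrable_continuous_interval contH)
  have per: "integral {a..a+2*pi} H = integral {0..2*pi} H" for a
    by (rule integral_period[OF contH]) (auto simp: H_def cis_add_2pi)
  have bound: "cmod (f 0) \<le> exp (circle_mean h R + e)" if e: "e > 0" for e
  proof -
    obtain d where d: "d > 0" "\<And>s t. \<bar>s - t\<bar> < d \<Longrightarrow> \<bar>H s - H t\<bar> < e"
      using uniformly_continuous_circle[OF conth R e] unfolding H_def by blast
    \<comment> \<open>With so many rotations the angular step \<open>q = 2 * pi / N\<close> is below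
      \<open>d\<close>, so \<open>H\<close> varies by less than \<open>e\<close> on each
      arc.\<close>
    obtain N :: nat where N: "real N > 2 * pi / d" using reals_Archimedean2 by blast
    have N0: "N > 0" using N d by (metis N divide_pos_pos gr0I less_asym of_nat_0 pi_gt_zero zero_less_mult_iff zero_less_numeral)
    define q where "q = 2 * pi / real N"
    have q: "0 < q" "q < d" using N N0 d by (simp_all add: q_def field_simps)
    have Nq: "real N * q = 2 * pi" using N0 by (simp add: q_def)
    \<comment> \<open>A left Riemann sum exceeds the integral by at most \<open>q * e\<close> per
      arc. The starting angle \<open>t\<close> is free because the bound is needed at every boundary
      point.\<close>
    have step: "(\<Sum>j<k. H (t + j * q)) * q \<le> integral {t..t + k * q} H + k * q * e" for t and k :: nat
    proof (induction k)
      case (Suc k)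
      have "integral {t + k * q..t + Suc k * q} (\<lambda>_. H (t + k * q) - e) \<le> integral {t + k * q..t + Suc k * q} H"
      proof (intro integral_le intH)
        fix s assume "s \<in> {t + k * q..t + Suc k * q}"
        then have "\<bar>s - (t + k * q)\<bar> < d" using q by (auto simp: algebra_simps)
        from d(2)[OF this] show "H (t + k * q) - e \<le> H s" by auto
      qed auto
      then have "(H (t + k * q) - e) * q \<le> integral {t + k * q..t + Suc k * q} H"
        using q by (simp add: algebra_simps)
      moreover have "integral {t..t + k * q} H + integral {t + k * q..t + Suc k * q} H = integral {t..t + Suc k * q} H"
        using q by (intro Henstock_Kurzweil_Integration.integral_combine intH) (auto simp: algebra_simps)
      ultimately show ?case using Suc by (simp add: algebra_simps)
    qed simp
    define G where "G = (\<lambda>z. \<Prod>j<N. f (z * cis (j * q)))"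
    have "cmod (G 0) \<le> exp (N * (circle_mean h R + e))"
    proof (rule maximum_modulus_frontier[of G "cball 0 R"])
      show "G holomorphic_on interior (cball 0 R)"
        unfolding G_def
        by (intro holomorphic_intros holomorphic_on_compose_gen[OF _ holf, unfolded o_def]) (auto simp: norm_mult)
      show "continuous_on (closure (cball 0 R)) G"
        unfolding G_def
        by (intro continuous_on_prod continuous_on_compose2[OF contf] continuous_on_mult
              continuous_on_id continuous_on_const) (auto simp: norm_mult)
      fix z assume "z \<in> frontier (cball (0::complex) R)"
      then have z: "cmod z = R" using R by simp
      define t where "t = Arg z"
      have zt: "z = complex_of_real R * cis t" using z R unfolding t_def
        by (metis rcis_cmod_Arg rcis_def)
      have "cmod (G z) = (\<Prod>j<N. cmod (f (z * cis (j * q))))"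
        by (simp add: G_def prod_norm)
      also have "\<dots> \<le> (\<Prod>j<N. exp (H (t + j * q)))"
      proof (intro prod_mono conjI norm_ge_zero)
        fix j
        have "cmod (f (z * cis (j * q))) \<le> exp (h (z * cis (j * q)))"
          by (rule le) (use z in \<open>simp add: norm_mult\<close>)
        then show "cmod (f (z * cis (j * q))) \<le> exp (H (t + j * q))"
          by (simp add: H_def zt cis_mult mult.assoc)
      qed
      also have "\<dots> = exp (\<Sum>j<N. H (t + j * q))" by (simp add: exp_sum)
      also have "\<dots> \<le> exp (N * (circle_mean h R + e))"
      proof -
        have "(\<Sum>j<N. H (t + j * q)) * q \<le> 2 * pi * circle_mean h R + 2 * pi * e"
          using step[of t N] Nq per[of t] by (simp add: circle_mean_def H_def)
        also have "\<dots> = N * (circle_mean h R + e) * q" using Nq by (simp add: algebra_simps)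
        finally show ?thesis using q by simp
      qed
      finally show "cmod (G z) \<le> exp (N * (circle_mean h R + e))" .
    qed (use R in auto)
    then have "cmod (f 0) ^ N \<le> exp (circle_mean h R + e) ^ N"
      by (simp add: G_def norm_power exp_of_nat_mult)
    then show ?thesis using N0 by (simp add: power_mono_iff)
  qed
  \<comment> \<open>Letting \<open>e\<close> tend to 0 is done after taking logarithms, so
    \<open>f 0 = 0\<close> is split off.\<close>
  show ?thesis
  proof (cases "f 0 = 0")
    case False
    have "ln (cmod (f 0)) \<le> circle_mean h R"
    proof (rule field_le_epsilon)
      fix e :: real assume "e > 0"
      from bound[OF this] show "ln (cmod (f 0)) \<le> circle_mean h R + e"
        using False by (metis ln_exp ln_mono zero_less_norm_iff)
    qed
    then show ?thesis using False by (metis exp_le_cancel_iff exp_ln zero_less_norm_iff)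
  qed simp
qed

section \<open>Positive logarithm, entire functions and circle means\<close>

lemma log_plus_eq: "log_plus x = ln (max 1 x)"
  by (auto simp: log_plus_def max_def)

lemma log_plus_nonneg [simp]: "log_plus x \<ge> 0"
  by (simp add: log_plus_eq)

lemma log_plus_mono: "x \<le> y \<Longrightarrow> log_plus x \<le> log_plus y"
  by (auto simp: log_plus_eq)

lemma ln_le_log_plus: "0 < x \<Longrightarrow> ln x \<le> log_plus x"
  by (simp add: log_plus_eq)

lemma le_exp_log_plus: "x \<le> exp (log_plus x)"
  by (simp add: log_plus_eq)

lemma log_plus_le_iff: "0 \<le> b \<Longrightarrow> log_plus x \<le> b \<longleftrightarrow> x \<le> exp b"
  unfolding log_plus_eq
  by (metis exp_ge_add_one_self exp_le_cancel_iff exp_ln le_add_same_cancel1 less_max_iff_disj max.bounded_iff one_le_exp_iff zero_less_one)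

lemma continuous_on_log_plus [continuous_intros]:
  "continuous_on A g \<Longrightarrow> continuous_on A (\<lambda>x. log_plus (g x))"
  unfolding log_plus_eq by (intro continuous_intros) (auto simp: max_def)

lemma entire_continuous_on: "entire f \<Longrightarrow> continuous_on A f"
  unfolding entire_def by (meson continuous_on_subset holomorphic_on_imp_continuous_on subset_UNIV)

lemma entire_holomorphic_on: "entire f \<Longrightarrow> f holomorphic_on A"
  unfolding entire_def by (meson holomorphic_on_subset subset_UNIV)

lemma entire_continuous_norm: "entire f \<Longrightarrow> continuous_on A (\<lambda>z. cmod (f z))"
  by (intro continuous_on_norm entire_continuous_on)

lemma entire_continuous_log_plus: "entire f \<Longrightarrow> continuous_on A (\<lambda>z. log_plus (cmod (f z)))"
  by (intro continuous_on_log_plus entire_continuous_norm)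

lemma entire_compose: "entire F \<Longrightarrow> entire f \<Longrightarrow> entire (F \<circ> f)"
  unfolding entire_def by (meson holomorphic_on_compose_gen subset_UNIV image_subset_iff UNIV_I)

lemma circle_integrable:
  assumes "continuous_on UNIV u"
  shows "(\<lambda>t. u (complex_of_real r * cis t) :: real) integrable_on {0..2*pi}"
  by (intro integrable_continuous_interval continuous_on_compose2[OF assms] continuous_intros) auto

lemma circle_mean_mono:
  assumes "continuous_on UNIV u" "continuous_on UNIV v" "\<And>z. cmod z = \<bar>r\<bar> \<Longrightarrow> u z \<le> v z"
  shows "circle_mean u r \<le> circle_mean v r"
  unfolding circle_mean_def
  by (intro divide_right_mono integral_le circle_integrable assms) (auto simp: norm_mult)

lemma circle_mean_const [simp]: "circle_mean (\<lambda>_. c) r = c"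
  by (simp add: circle_mean_def)

lemma circle_mean_add:
  assumes "continuous_on UNIV u" "continuous_on UNIV v"
  shows "circle_mean (\<lambda>z. u z + v z) r = circle_mean u r + circle_mean v r"
  unfolding circle_mean_def by (simp add: Henstock_Kurzweil_Integration.integral_add circle_integrable assms add_divide_distrib)

lemma circle_mean_cmult: "circle_mean (\<lambda>z. c * u z) r = c * circle_mean u r"
  unfolding circle_mean_def by simp

lemma circle_mean_sum:
  assumes "finite I" "\<And>i. i \<in> I \<Longrightarrow> continuous_on UNIV (u i)"
  shows "circle_mean (\<lambda>z. \<Sum>i\<in>I. u i z) r = (\<Sum>i\<in>I. circle_mean (u i) r)"
  unfolding circle_mean_def
  by (subst integral_sum) (auto intro: assms circle_integrable simp: sum_divide_distrib)

text \<open>Holds for arbitrary \<open>f\<close>: if the integrand is not integrable,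
  \<open>integral\<close> takes the default value 0.\<close>

lemma nev_T_nonneg [simp]: "nev_T f r \<ge> 0"
  unfolding nev_T_def by (cases "(\<lambda>t. log_plus (cmod (f (complex_of_real r * cis t)))) integrable_on {0..2*pi}")
    (auto intro!: divide_nonneg_nonneg integral_nonneg simp: not_integrable_integral)

text \<open>The supremum runs over the closed disc, which makes monotonicity in \<open>r\<close>
  immediate; the maximum principle brings it back to the circle. For negative \<open>r\<close> the
  disc is empty, whence the sign conditions on radii below.\<close>

definition max_mod :: "(complex \<Rightarrow> complex) \<Rightarrow> real \<Rightarrow> real" where
  "max_mod f r = (SUP z\<in>cball 0 r. cmod (f z))"

lemma max_mod_bdd: "entire f \<Longrightarrow> bdd_above ((\<lambda>z. cmod (f z)) ` cball 0 r)"
  by (intro bounded_imp_bdd_above compact_imp_bounded compact_continuous_image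
      entire_continuous_norm) auto

lemma norm_le_max_mod: "entire f \<Longrightarrow> cmod z \<le> r \<Longrightarrow> cmod (f z) \<le> max_mod f r"
  unfolding max_mod_def by (rule cSUP_upper[OF _ max_mod_bdd]) auto

lemma max_mod_attained:
  assumes "entire f" "r \<ge> 0"
  obtains z where "cmod z \<le> r" "cmod (f z) = max_mod f r"
proof -
  have "\<exists>z\<in>cball 0 r. \<forall>w\<in>cball 0 r. cmod (f w) \<le> cmod (f z)"
    by (rule continuous_attains_sup[OF _ _ entire_continuous_norm[OF assms(1)]]) (use assms in auto)
  then obtain z where z: "cmod z \<le> r" "\<And>w. cmod w \<le> r \<Longrightarrow> cmod (f w) \<le> cmod (f z)" by auto
  have "max_mod f r \<le> cmod (f z)"
    unfolding max_mod_def by (rule cSUP_least) (use z assms in auto)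
  then show ?thesis using that[OF z(1)] norm_le_max_mod[OF assms(1) z(1)] by auto
qed

lemma max_mod_le: "r \<ge> 0 \<Longrightarrow> (\<And>z. cmod z \<le> r \<Longrightarrow> cmod (f z) \<le> B) \<Longrightarrow> max_mod f r \<le> B"
  unfolding max_mod_def by (rule cSUP_least) auto

lemma max_mod_mono: "entire f \<Longrightarrow> 0 \<le> r \<Longrightarrow> r \<le> s \<Longrightarrow> max_mod f r \<le> max_mod f s"
  by (rule max_mod_le) (auto intro: norm_le_max_mod)

lemma max_mod_nonneg: "entire f \<Longrightarrow> r \<ge> 0 \<Longrightarrow> max_mod f r \<ge> 0"
  using norm_le_max_mod[of f 0 r] order_trans[OF norm_ge_zero[of "f 0"]] by simp

text \<open>The maximum modulus principle moves the maximum over the disc to its boundary. A maximum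
  point on the circle itself is what the covering argument can lift through
  \<open>f\<close>.\<close>

lemma max_mod_attained_sphere:
  assumes f: "entire f" and r: "r \<ge> 0"
  obtains z where "cmod z = r" "cmod (f z) = max_mod f r"
proof -
  have "\<exists>z\<in>sphere 0 r. \<forall>w\<in>sphere 0 r. cmod (f w) \<le> cmod (f z)"
    by (rule continuous_attains_sup[OF _ _ entire_continuous_norm[OF assms(1)]]) (use assms in auto)
  then obtain z where z: "cmod z = r" "\<And>w. cmod w = r \<Longrightarrow> cmod (f w) \<le> cmod (f z)" by auto
  have "max_mod f r \<le> cmod (f z)"
  proof (rule max_mod_le[OF r])
    fix w assume "cmod w \<le> r"
    then show "cmod (f w) \<le> cmod (f z)"
      by - (rule maximum_modulus_frontier[OF entire_holomorphic_on[OF f] entire_continuous_on[OF f], of "cball 0 r"],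
          use z in auto)
  qed
  then show ?thesis using that[OF z(1)] norm_le_max_mod[OF f, of z r] z(1) by auto
qed

lemma nev_T_le_log_plus_max_mod:
  assumes "entire f" "r \<ge> 0"
  shows "nev_T f r \<le> log_plus (max_mod f r)"
proof -
  have "circle_mean (\<lambda>z. log_plus (cmod (f z))) r \<le> circle_mean (\<lambda>_. log_plus (max_mod f r)) r"
    using assms
    by (intro circle_mean_mono entire_continuous_log_plus continuous_on_const log_plus_mono norm_le_max_mod) auto
  then show ?thesis by (simp add: nev_T_eq_circle_mean)
qed

section \<open>Maximum modulus bounded by the characteristic\<close>

text \<open>On the unit circle the disc automorphism \<open>z \<mapsto> (z + a) / (1 + cnj a * z)\<close> is the
  reparametrisation \<open>t \<mapsto> t - 2 arg (1 + cnj a * cis t)\<close> of the angle, whose speed is the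
  reciprocal of the Poisson kernel, hence at least \<open>1/3\<close> for \<open>\<bar>a\<bar> \<le> 1/2\<close>.\<close>

lemma circle_mean_disc_automorphism_le:
  fixes h :: "complex \<Rightarrow> real"
  assumes h: "continuous_on UNIV h" and hpos: "\<And>z. h z \<ge> 0" and a: "cmod a \<le> 1/2"
  shows "circle_mean (\<lambda>z. h ((z + a) / (1 + cnj a * z))) 1 \<le> 3 * circle_mean h 1"
proof -
  \<comment> \<open>Since \<open>cnj a * cis t\<close> has modulus at most 1/2, \<open>w t\<close>
    stays in the right half-plane, where the principal \<open>Ln\<close> is smooth; hence
    \<open>s\<close> is a differentiable angle.\<close>
  define w where "w = (\<lambda>t. 1 + cnj a * cis t)"
  define s where "s = (\<lambda>t. t - 2 * Im (Ln (w t)))"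
  define s' where "s' = (\<lambda>t. 1 - 2 * Re (cnj a * cis t / w t))"
  have cl: "cmod (cnj a * cis t) \<le> 1/2" for t using a by (simp add: norm_mult)
  have Rew: "Re (w t) > 0" for t
    using cl[of t] abs_Re_le_cmod[of "cnj a * cis t"] unfolding w_def by simp
  have w0: "w t \<noteq> 0" for t using Rew[of t] by auto
  have nonpos: "w t \<notin> \<real>\<^sub>\<le>\<^sub>0" for t using Rew[of t] complex_nonpos_Reals_iff by fastforce
  have deriv: "(s has_field_derivative s' t) (at t within A)" for t A
  proof -
    have "(w has_vector_derivative (cnj a * (\<i> * cis t))) (at t within A)"
      unfolding w_def has_vector_derivative_def
      by (auto intro!: derivative_eq_intros simp: algebra_simps)
    then have "((\<lambda>t. Ln (w t)) has_vector_derivative (cnj a * (\<i> * cis t)) * (1 / w t)) (at t within A)"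
      by (rule field_vector_diff_chain_within[unfolded o_def])
         (use nonpos w0 in \<open>auto intro!: derivative_eq_intros simp: field_simps\<close>)
    from bounded_linear.has_vector_derivative[OF bounded_linear_Im this]
    have "((\<lambda>t. Im (Ln (w t))) has_field_derivative Im ((cnj a * (\<i> * cis t)) * (1 / w t))) (at t within A)"
      by (simp add: has_real_derivative_iff_has_vector_derivative)
    moreover have "Im ((cnj a * (\<i> * cis t)) * (1 / w t)) = Re (cnj a * cis t / w t)"
    proof -
      have "(cnj a * (\<i> * cis t)) * (1 / w t) = \<i> * (cnj a * cis t / w t)" by simp
      then show ?thesis by (simp only: Im_i_times)
    qed
    ultimately have "((\<lambda>t. Im (Ln (w t))) has_field_derivative Re (cnj a * cis t / w t)) (at t within A)"
      by simp
    then show ?thesis unfolding s_def s'_def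
      by (intro DERIV_diff DERIV_ident DERIV_cmult)
  qed
  have s'_ge: "s' t \<ge> 1/3" for t
  proof -
    have "cnj a * cis t / w t = 1 - 1 / w t" using w0[of t] by (simp add: w_def field_simps)
    then have 1: "s' t = 2 * Re (1 / w t) - 1" by (simp add: s'_def)
    have "Re (1 / w t) = Re (w t) / (cmod (w t))\<^sup>2"
      by (simp add: Re_divide cmod_power2)
    \<comment> \<open>With \<open>cnj a * cis t = x + i y\<close> this reads 1 - x - 2 (x^2 + y^2)
      \<ge> 0, which follows from \<bar>x\<bar> \<le> 1/2 and x^2 + y^2 \<le> 1/4.\<close>
    moreover have "3 * Re (w t) \<ge> 2 * (cmod (w t))\<^sup>2"
    proof -
      define x y where "x = Re (cnj a * cis t)" and "y = Im (cnj a * cis t)"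
      have "(cmod (cnj a * cis t))\<^sup>2 \<le> (1/2)\<^sup>2" using cl[of t] by (intro power_mono) auto
      then have xy: "x\<^sup>2 + y\<^sup>2 \<le> 1/4" unfolding cmod_power2 x_def y_def by (simp add: power_divide)
      have "\<bar>x\<bar> \<le> 1/2" using cl[of t] abs_Re_le_cmod[of "cnj a * cis t"] unfolding x_def by linarith
      moreover have "Re (w t) = 1 + x" "(cmod (w t))\<^sup>2 = (1 + x)\<^sup>2 + y\<^sup>2"
        unfolding cmod_power2 x_def y_def w_def by simp_all
      ultimately show ?thesis using xy by (simp add: power2_eq_square algebra_simps)
    qed
    moreover have "(cmod (w t))\<^sup>2 > 0" using w0[of t] by simp
    ultimately have "Re (1 / w t) \<ge> 2/3" by (simp add: le_divide_eq del: zero_less_power2)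
    then show ?thesis using 1 by simp
  qed
  \<comment> \<open>On the unit circle the numerator is \<open>cis t * cnj (w t)\<close>, and
    dividing \<open>cnj (w t)\<close> by \<open>w t\<close> subtracts twice the argument of
    \<open>w t\<close>.\<close>
  have on_circle: "(cis t + a) / (1 + cnj a * cis t) = cis (s t)" for t
  proof -
    have "cis t + a = cis t * cnj (w t)"
      by (simp add: w_def algebra_simps cis_cnj[symmetric]) (simp add: cis_cnj cis_mult)
    moreover have "cnj (w t) / w t = cis (- 2 * Im (Ln (w t)))"
    proof -
      have "w t = exp (Ln (w t))" using w0 by simp
      then have "w t = exp (Re (Ln (w t))) * cis (Im (Ln (w t)))" by (metis exp_eq_polar)
      then have "cnj (w t) / w t = cis (- Im (Ln (w t))) / cis (Im (Ln (w t)))"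
        by (metis (no_types, lifting) cis_cnj complex_cnj_complex_of_real complex_cnj_mult exp_not_eq_zero mult_divide_mult_cancel_left of_real_eq_0_iff)
      then show ?thesis by (simp add: cis_divide)
    qed
    ultimately show ?thesis unfolding s_def
      by (simp add: w_def cis_mult[symmetric] flip: times_divide_eq_right diff_conv_add_uminus) (simp add: cis_mult)
  qed
  have contH: "continuous_on A (\<lambda>t. h (cis t))" for A
    by (intro continuous_on_compose2[OF h] continuous_intros) auto
  have conts: "continuous_on A s" for A using deriv by (meson DERIV_continuous_on)
  \<comment> \<open>\<open>w\<close> returns to its initial value, so the logarithm contributes
    nothing and the image runs exactly once round the circle.\<close>
  have s2: "s (2 * pi) = s 0 + 2 * pi" by (simp add: s_def w_def)
  have s_mono: "s x \<le> s y" if "x \<le> y" for x y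
    using DERIV_nonneg_imp_nondecreasing[OF that, of s] deriv s'_ge
    by (metis (no_types, opaque_lifting) dual_order.trans divide_nonneg_nonneg zero_le_numeral zero_le_one)
  have "((\<lambda>t. s' t *\<^sub>R h (cis (s t))) has_integral integral {s 0..s (2*pi)} (\<lambda>t. h (cis t))) {0..2*pi}"
    by (rule has_integral_substitution[where c = "s 0" and d = "s (2*pi)"])
       (auto intro: s_mono contH deriv)
  moreover have "integral {s 0..s (2*pi)} (\<lambda>t. h (cis t)) = integral {0..2*pi} (\<lambda>t. h (cis t))"
    unfolding s2 by (rule integral_period[OF contH]) (auto simp: cis_add_2pi)
  ultimately have I: "((\<lambda>t. s' t * h (cis (s t))) has_integral integral {0..2*pi} (\<lambda>t. h (cis t))) {0..2*pi}"
    by simp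
  have "integral {0..2*pi} (\<lambda>t. h (cis (s t))) \<le> 3 * integral {0..2*pi} (\<lambda>t. h (cis t))"
  proof (rule has_integral_le)
    show "((\<lambda>t. h (cis (s t))) has_integral integral {0..2*pi} (\<lambda>t. h (cis (s t)))) {0..2*pi}"
      by (intro integrable_integral integrable_continuous_interval continuous_on_compose2[OF contH conts]) auto
    show "((\<lambda>t. 3 * (s' t * h (cis (s t)))) has_integral 3 * integral {0..2*pi} (\<lambda>t. h (cis t))) {0..2*pi}"
      by (rule has_integral_mult_right[OF I])
    show "h (cis (s t)) \<le> 3 * (s' t * h (cis (s t)))" for t
      using mult_right_mono[OF s'_ge[of t] hpos[of "cis (s t)"]] by simp
  qed
  then show ?thesis by (simp add: circle_mean_def on_circle divide_right_mono)
qed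

text \<open>The classical bound log M(r) \<le> (R + r) / (R - r) T(R) at r = R/2. A disc
  automorphism carries the centre to a maximum point of the smaller disc; there the mean value
  inequality applies, and the change of angle costs the factor 3.\<close>

lemma log_plus_max_mod_le_nev_T:
  assumes f: "entire f" and R: "R > 0"
  shows "log_plus (max_mod f (R/2)) \<le> 3 * nev_T f R"
proof -
  obtain z where z: "cmod z \<le> R/2" "cmod (f z) = max_mod f (R/2)"
    using max_mod_attained[OF f, of "R/2"] R by auto
  define a where "a = z / complex_of_real R"
  have a: "cmod a \<le> 1/2" using z R by (simp add: a_def norm_divide)
  define \<phi> where "\<phi> = (\<lambda>\<zeta>. (\<zeta> + a) / (1 + cnj a * \<zeta>))"
  define h where "h = (\<lambda>\<zeta>. log_plus (cmod (f (complex_of_real R * \<zeta>))))"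
  have nz: "1 + cnj a * \<zeta> \<noteq> 0" if "cmod \<zeta> \<le> 1" for \<zeta>
  proof -
    have "cmod (cnj a * \<zeta>) \<le> 1/2 * 1"
      unfolding norm_mult by (rule mult_mono) (use a that in auto)
    then show ?thesis
      by (metis add_eq_0_iff2 add.commute mult.right_neutral norm_minus_cancel norm_one not_one_le_zero
          le_divide_eq_1_pos numeral_le_one_iff one_le_numeral zero_less_numeral semiring_norm(69))
  qed
  have h: "continuous_on UNIV h"
    unfolding h_def
    by (intro continuous_intros continuous_on_compose2[OF entire_continuous_on[OF f, of UNIV]]) auto
  have holphi: "\<phi> holomorphic_on cball 0 1"
    unfolding \<phi>_def by (intro holomorphic_intros) (use nz in auto)
  have hol: "(\<lambda>\<zeta>. f (complex_of_real R * \<phi> \<zeta>)) holomorphic_on cball 0 1"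
    by (intro holomorphic_on_compose_gen[OF _ entire_holomorphic_on[OF f, of UNIV], unfolded o_def]
        holomorphic_intros holphi) auto
  have "cmod (f (complex_of_real R * \<phi> 0)) \<le> exp (circle_mean (\<lambda>\<zeta>. h (\<phi> \<zeta>)) 1)"
  proof (rule mean_value_majorant)
    show "(\<lambda>\<zeta>. f (complex_of_real R * \<phi> \<zeta>)) holomorphic_on ball 0 1"
      using hol by (rule holomorphic_on_subset) auto
    show "continuous_on (cball 0 1) (\<lambda>\<zeta>. f (complex_of_real R * \<phi> \<zeta>))"
      by (rule holomorphic_on_imp_continuous_on[OF hol])
    show "continuous_on (sphere 0 1) (\<lambda>\<zeta>. h (\<phi> \<zeta>))"
      by (intro continuous_on_compose2[OF h] holomorphic_on_imp_continuous_on
          holomorphic_on_subset[OF holphi]) auto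
    show "cmod (f (complex_of_real R * \<phi> \<zeta>)) \<le> exp (h (\<phi> \<zeta>))" for \<zeta>
      by (simp add: h_def le_exp_log_plus)
  qed auto
  also have "circle_mean (\<lambda>\<zeta>. h (\<phi> \<zeta>)) 1 \<le> 3 * circle_mean h 1"
    unfolding \<phi>_def by (rule circle_mean_disc_automorphism_le[OF h _ a]) (simp add: h_def)
  also have "circle_mean h 1 = nev_T f R"
    by (simp add: circle_mean_def nev_T_def h_def)
  finally show ?thesis
    using R z(2) by (simp add: log_plus_le_iff \<phi>_def a_def)
qed

section \<open>Growth of the maximum modulus\<close>

text \<open>The maximum modulus principle for \<open>F\<^sup>N / z\<^sup>q\<close> on the annulus \<open>1 \<le> \<bar>z\<bar> \<le> R\<^sup>N\<close>, with \<open>q\<close>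
  the least exponent making the outer boundary value at most \<open>1\<close>.\<close>

lemma max_mod_root_le:
  assumes F: "entire F" and N: "N \<ge> 1" and R: "R > 1" and M: "max_mod F (R ^ N) \<ge> 1"
  shows "max_mod F R ^ N \<le> (max 1 (max_mod F 1)) ^ N * (R * max_mod F (R ^ N))"
proof -
  define S where "S = R ^ N"
  define A where "A = max_mod F S ^ N"
  define C where "C = max 1 (max_mod F 1) ^ N"
  have S: "S > 1" unfolding S_def using R N by (intro one_less_power) auto
  have A: "A \<ge> 1" unfolding A_def S_def using M by (rule one_le_power)
  have C: "C \<ge> 1" unfolding C_def by (rule one_le_power) simp
  obtain q where q: "A \<le> S ^ q" "S ^ q \<le> S * A"
  proof -
    obtain k where "A < S ^ k" using real_arch_pow[OF S] by blast
    then have ex: "\<exists>k. A \<le> S ^ k" by (meson less_imp_le)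
    define q where "q = (LEAST k. A \<le> S ^ k)"
    have q1: "A \<le> S ^ q" unfolding q_def by (rule LeastI_ex[OF ex])
    have "S ^ q \<le> S * A"
    proof (cases q)
      case 0
      have "1 * 1 \<le> S * A" by (rule mult_mono) (use S A in auto)
      then show ?thesis using 0 by simp
    next
      case (Suc p)
      then have "\<not> A \<le> S ^ p" using not_less_Least[of p "\<lambda>k. A \<le> S ^ k"] unfolding q_def by auto
      then show ?thesis using Suc S by simp
    qed
    then show ?thesis using that q1 by blast
  qed
  obtain z where z: "cmod z = R" "cmod (F z) = max_mod F R"
    using max_mod_attained_sphere[OF F, of R] R by auto
  have RS: "R \<le> S" unfolding S_def using R N self_le_power[of R N] by simp
  define K where "K = cball (0::complex) S - ball 0 1"
  have fr: "frontier K \<subseteq> sphere 0 1 \<union> sphere 0 S"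
  proof -
    have "closed K" unfolding K_def by auto
    moreover have "ball 0 S - cball 0 1 \<subseteq> interior K"
      unfolding K_def by (rule interior_maximal) auto
    ultimately have "frontier K \<subseteq> K - (ball 0 S - cball 0 1)" unfolding frontier_def by auto
    then show ?thesis unfolding K_def by force
  qed
  have K0: "w \<noteq> 0" if "w \<in> K" for w using that unfolding K_def by auto
  have hol: "(\<lambda>w. F w ^ N / w ^ q) holomorphic_on K"
    by (intro holomorphic_intros entire_holomorphic_on[OF F]) (use K0 in auto)
  have "cmod (F z ^ N / z ^ q) \<le> C"
  proof (rule maximum_modulus_frontier[of "\<lambda>w. F w ^ N / w ^ q" K])
    show "(\<lambda>w. F w ^ N / w ^ q) holomorphic_on interior K"
      using hol interior_subset holomorphic_on_subset by blast
    have "closure K = K" unfolding K_def by (intro closure_closed) auto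
    then show "continuous_on (closure K) (\<lambda>w. F w ^ N / w ^ q)"
      using hol holomorphic_on_imp_continuous_on by auto
    show "bounded K" unfolding K_def by (rule bounded_subset[OF bounded_cball]) auto
    show "z \<in> K" unfolding K_def using z R RS by auto
    fix w assume "w \<in> frontier K"
    then consider "cmod w = 1" | "cmod w = S" using fr by auto
    then show "cmod (F w ^ N / w ^ q) \<le> C"
    proof cases
      case 1
      have "cmod (F w) \<le> max 1 (max_mod F 1)"
        using norm_le_max_mod[OF F, of w 1] 1 by simp
      then show ?thesis unfolding C_def by (simp add: norm_divide norm_power 1 power_mono)
    next
      case 2
      have "cmod (F w) ^ N \<le> A" unfolding A_def
        by (intro power_mono norm_le_max_mod F) (use 2 in auto)
      then have "cmod (F w) ^ N \<le> S ^ q" using q by linarith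
      then have "cmod (F w ^ N / w ^ q) \<le> 1" using S by (simp add: norm_divide norm_power 2)
      then show ?thesis using C by linarith
    qed
  qed
  then have 1: "max_mod F R ^ N \<le> C * R ^ q"
    using z R by (simp add: norm_divide norm_power field_simps)
  \<comment> \<open>As \<open>S = R ^ N\<close>, the upper bound \<open>S ^ q \<le> S * A\<close> is
    an inequality between \<open>N\<close>-th powers, and the root can be taken.\<close>
  have "(R ^ q) ^ N \<le> (R * max_mod F S) ^ N"
    using q(2) unfolding S_def A_def by (simp add: power_mult_distrib mult.commute flip: power_mult)
  then have "R ^ q \<le> R * max_mod F S"
    using N R M unfolding S_def by (subst (asm) power_mono_iff) auto
  then have "C * R ^ q \<le> C * (R * max_mod F S)"
    using C by (intro mult_left_mono) auto
  then show ?thesis using 1 unfolding C_def S_def by linarith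
qed

text \<open>The exponential is Schottky's bound on the disc of radius 1/2 for a value of modulus at
  most 2 at the centre: 2 + 2 * 2 + 12 = 18. With \<open>S\<close> for this bound, the denominator
  \<open>3 * S + 2\<close> just exceeds the \<open>3 * S + 1\<close> of the final estimate in the
  covering lemma.\<close>

definition bohr_const :: real where
  "bohr_const = 1 / (3 * exp (pi * exp (18 * pi)) + 2)"

lemma bohr_const_pos: "bohr_const > 0"
  unfolding bohr_const_def by (intro divide_pos_pos add_pos_pos mult_pos_pos) auto

text \<open>If some point of each of the circles of radii \<open>cM\<close> and \<open>2cM\<close> were omitted, Schottky's
  theorem would bound \<open>f\<close> on the smaller disc below its maximum modulus there.\<close>

lemma image_covers_circle:
  assumes f: "entire f" and r: "r > 0" and f0: "cmod (f 0) \<le> bohr_const * max_mod f r"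
    and M: "max_mod f r > 0"
  obtains R where "R \<ge> bohr_const * max_mod f r" "sphere 0 R \<subseteq> f ` cball 0 (2 * r)"
proof (rule ccontr)
  assume neg: "\<not> thesis"
  define M where "M = max_mod f r"
  define c where "c = bohr_const"
  define S where "S = exp (pi * exp (18 * pi))"
  have c: "c > 0" "c * (3 * S + 2) = 1"
    using bohr_const_pos unfolding c_def bohr_const_def S_def by (auto simp: add_pos_pos less_imp_neq[symmetric])
  have cM: "c * M > 0" using c assms(4) unfolding M_def by simp
  have "\<not> sphere 0 (c * M) \<subseteq> f ` cball 0 (2 * r)" "\<not> sphere 0 (2 * (c * M)) \<subseteq> f ` cball 0 (2 * r)"
    using that[of "c * M"] that[of "2 * (c * M)"] neg cM unfolding c_def M_def by auto
  then obtain w1 w2 where w: "cmod w1 = c * M" "w1 \<notin> f ` cball 0 (2 * r)"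
      "cmod w2 = 2 * (c * M)" "w2 \<notin> f ` cball 0 (2 * r)"
    unfolding subset_iff mem_sphere_0 by blast
  have d1: "c * M \<le> cmod (w2 - w1)" using norm_triangle_ineq2[of w2 w1] w by linarith
  have d2: "cmod (w2 - w1) \<le> 3 * (c * M)" using norm_triangle_ineq4[of w2 w1] w by linarith
  have ne: "w2 - w1 \<noteq> 0" using d1 cM by auto
  \<comment> \<open>The two omitted values become 0 and 1, and the disc of radius
    \<open>2 * r\<close> becomes the unit disc, so that Schottky's theorem applies and radius
    \<open>r\<close> corresponds to 1/2.\<close>
  define g where "g = (\<lambda>z. (f (complex_of_real (2 * r) * z) - w1) / (w2 - w1))"
  have bound: "cmod (g z) \<le> S" if "cmod z \<le> 1/2" for z
  proof -
    have "cmod (g z) \<le> exp (pi * exp (pi * (2 + 2 * 2 + 12 * (1/2) / (1 - 1/2))))"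
    proof (rule Schottky[of g])
      show "g holomorphic_on cball 0 1" unfolding g_def
        by (intro holomorphic_intros holomorphic_on_compose_gen[OF _ entire_holomorphic_on[OF f, of UNIV], unfolded o_def])
           (use ne in auto)
      have "cmod (f 0 - w1) \<le> 2 * (c * M)"
        using norm_triangle_ineq4[of "f 0" w1] w f0 unfolding c_def M_def by simp
      also have "\<dots> \<le> 2 * cmod (w2 - w1)" using d1 by simp
      finally show "cmod (g 0) \<le> 2" using ne by (simp add: g_def norm_divide divide_le_eq)
      fix y :: complex assume "y \<in> cball 0 1"
      then have "complex_of_real (2 * r) * y \<in> cball 0 (2 * r)"
        using r by (simp add: norm_mult)
      then have "f (complex_of_real (2 * r) * y) \<noteq> w1" "f (complex_of_real (2 * r) * y) \<noteq> w2"
        using w by blast+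
      then show "\<not> (g y = 0 \<or> g y = 1)" using ne by (simp add: g_def)
    qed (use that in auto)
    then show ?thesis by (simp add: S_def mult.commute)
  qed
  obtain z where z: "cmod z \<le> r" "cmod (f z) = M"
    using max_mod_attained[OF f, of r] r unfolding M_def by auto
  define y where "y = z / complex_of_real (2 * r)"
  have y: "cmod y \<le> 1/2" using z r by (simp add: y_def norm_divide field_simps)
  have fz: "f z = g y * (w2 - w1) + w1"
    using ne r by (simp add: g_def y_def)
  \<comment> \<open>Undoing the normalisation at a maximum point gives M \<le> (3 S + 1) c M, while
    (3 S + 2) c = 1.\<close>
  have "M \<le> cmod (g y) * cmod (w2 - w1) + cmod w1"
    using norm_triangle_ineq[of "g y * (w2 - w1)" w1] z fz by (simp add: norm_mult)
  also have "\<dots> \<le> S * (3 * (c * M)) + c * M"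
    using mult_mono[OF bound[OF y] d2] w(1) by (simp add: S_def)
  also have "\<dots> < (c * (3 * S + 2)) * M" using cM by (simp add: algebra_simps)
  also have "\<dots> = M" using c by simp
  finally show False by simp
qed

text \<open>\<open>f\<close> covers a whole circle of radius at least
  \<open>bohr_const * max_mod f r\<close>, hence also the point of that circle where
  \<open>F\<close> is largest.\<close>

lemma max_mod_compose_ge:
  assumes F: "entire F" and f: "entire f" and r: "r > 0"
    and f0: "cmod (f 0) \<le> bohr_const * max_mod f r" and M: "max_mod f r > 0"
  shows "max_mod F (bohr_const * max_mod f r) \<le> max_mod (F \<circ> f) (2 * r)"
proof -
  obtain R where R: "R \<ge> bohr_const * max_mod f r" "sphere 0 R \<subseteq> f ` cball 0 (2 * r)"
    by (rule image_covers_circle[OF f r f0 M])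
  have pos: "bohr_const * max_mod f r > 0" using bohr_const_pos M by simp
  obtain w where w: "cmod w = R" "cmod (F w) = max_mod F R"
    using max_mod_attained_sphere[OF F, of R] pos R by auto
  then have "w \<in> f ` cball 0 (2 * r)" using R by auto
  then obtain z where z: "cmod z \<le> 2 * r" "w = f z" by auto
  have "max_mod F (bohr_const * max_mod f r) \<le> max_mod F R"
    by (rule max_mod_mono[OF F]) (use pos R in auto)
  also have "\<dots> = cmod ((F \<circ> f) z)" using w z by simp
  also have "\<dots> \<le> max_mod (F \<circ> f) (2 * r)"
    by (rule norm_le_max_mod[OF entire_compose[OF F f] z(1)])
  finally show ?thesis .
qed

lemma max_mod_compose_le:
  assumes "entire F" "entire f" "r \<ge> 0"
  shows "max_mod (F \<circ> f) r \<le> max_mod F (max_mod f r)"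
  by (rule max_mod_le) (use assms in \<open>auto intro!: norm_le_max_mod\<close>)

text \<open>A transcendental function has a nonzero Taylor coefficient of some index above
  \<open>N\<close>. Cauchy's estimate for it leaves at least one spare factor \<open>r\<close>,
  which absorbs \<open>B\<close>.\<close>

lemma max_mod_ge_power:
  assumes f: "transcendental_entire f"
  shows "\<forall>\<^sub>F r in at_top. max_mod f r \<ge> B * r ^ N"
proof -
  have ent: "entire f" and np: "\<not> (\<exists>p. \<forall>z. f z = poly p z)"
    using f unfolding transcendental_entire_def by auto
  define a where "a = (\<lambda>k. (deriv ^^ k) f 0 / fact k)"
  have ps: "(\<lambda>k. a k * z ^ k) sums f z" for z
    using holomorphic_power_series[OF entire_holomorphic_on[OF ent], of z 0 "cmod z + 1"]
    by (simp add: a_def)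
  have "\<exists>k>N. a k \<noteq> 0"
  proof (rule ccontr)
    assume "\<not> (\<exists>k>N. a k \<noteq> 0)"
    then have z: "a k = 0" if "k \<notin> {..N}" for k using that by auto
    have "f z = poly (\<Sum>k\<le>N. monom (a k) k) z" for z
    proof -
      have "(\<lambda>k. a k * z ^ k) sums (\<Sum>k\<le>N. a k * z ^ k)"
        by (rule sums_finite) (use z in auto)
      then show ?thesis using ps[of z] sums_unique2 by (fastforce simp: poly_sum poly_monom)
    qed
    then show False using np by blast
  qed
  then obtain k where k: "k > N" "a k \<noteq> 0" by blast
  have "\<forall>\<^sub>F r in at_top. r \<ge> max 1 (\<bar>B\<bar> / cmod (a k))" by (rule eventually_ge_at_top)
  then show ?thesis
  proof eventually_elim
    case (elim r)
    then have r: "r \<ge> 1" "\<bar>B\<bar> \<le> cmod (a k) * r" using k by (auto simp: field_simps)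
    have "norm ((deriv ^^ k) f 0) \<le> fact k * max_mod f r / r ^ k"
      by (rule Cauchy_inequality[OF entire_holomorphic_on[OF ent] entire_continuous_on[OF ent]])
         (use r norm_le_max_mod[OF ent] in auto)
    then have M: "cmod (a k) * r ^ k \<le> max_mod f r"
      using r by (simp add: a_def norm_divide field_simps)
    have "B * r ^ N \<le> (cmod (a k) * r) * r ^ N"
      by (rule mult_right_mono) (use r in auto)
    also have "\<dots> = cmod (a k) * r ^ (Suc N)" by simp
    also have "\<dots> \<le> cmod (a k) * r ^ k"
      by (intro mult_left_mono power_increasing) (use r k in auto)
    finally show ?case using M by linarith
  qed
qed

section \<open>Algebraic relations and the characteristic\<close>

lemma log_plus_mult_le:
  assumes "0 \<le> x" "0 \<le> y"
  shows "log_plus (x * y) \<le> log_plus x + log_plus y"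
  using mult_mono[OF le_exp_log_plus[of x] le_exp_log_plus[of y]] assms
  by (simp add: log_plus_le_iff exp_add)

lemma log_plus_power_le:
  assumes "0 \<le> x"
  shows "log_plus (x ^ n) \<le> n * log_plus x"
  using power_mono[OF le_exp_log_plus[of x] assms, of n]
  by (simp add: log_plus_le_iff exp_of_nat_mult)

lemma log_plus_prod_le:
  assumes "\<And>i. i \<in> I \<Longrightarrow> 0 \<le> x i"
  shows "log_plus (\<Prod>i\<in>I. x i) \<le> (\<Sum>i\<in>I. log_plus (x i))"
proof (cases "finite I")
  case True
  have "(\<Prod>i\<in>I. x i) \<le> (\<Prod>i\<in>I. exp (log_plus (x i)))"
    using assms by (intro prod_mono) (auto simp: le_exp_log_plus)
  then show ?thesis using True by (simp add: log_plus_le_iff sum_nonneg exp_sum)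
qed (simp add: log_plus_def)

lemma log_plus_sum_le:
  "log_plus (\<Sum>i\<in>I. x i) \<le> log_plus (card I) + (\<Sum>i\<in>I. log_plus (x i))"
proof (cases "finite I")
  case True
  have "(\<Sum>i\<in>I. x i) \<le> (\<Sum>i\<in>I. exp (\<Sum>i\<in>I. log_plus (x i)))"
  proof (rule sum_mono)
    fix i assume "i \<in> I"
    have "x i \<le> exp (log_plus (x i))" by (rule le_exp_log_plus)
    also have "\<dots> \<le> exp (\<Sum>i\<in>I. log_plus (x i))"
      using member_le_sum[of i I "\<lambda>i. log_plus (x i)"] True \<open>i \<in> I\<close> by simp
    finally show "x i \<le> exp (\<Sum>i\<in>I. log_plus (x i))" .
  qed
  also have "\<dots> \<le> exp (log_plus (card I)) * exp (\<Sum>i\<in>I. log_plus (x i))"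
    by (simp add: le_exp_log_plus)
  finally show ?thesis by (simp add: log_plus_le_iff sum_nonneg exp_add)
qed (simp add: log_plus_def)

text \<open>The bound is pointwise with \<open>B\<close> independent of \<open>z\<close>, so taking
  circle means turns it into one by characteristics. \<open>B\<close> adds up the coefficient
  constants and all exponents, and thereby dominates each of them.\<close>

lemma log_plus_mpoly_eval_le:
  obtains B where "B \<ge> 0"
    "\<And>z. log_plus (cmod (mpoly_eval k c hs z)) \<le> B * (1 + (\<Sum>i<k. log_plus (cmod (hs i z))))"
proof -
  define S where "S = {m. c m \<noteq> 0}"
  define K where "K = log_plus (card S) + (\<Sum>m\<in>S. log_plus (cmod (c m)))"
  define B where "B = K + (\<Sum>i<k. real (\<Sum>m\<in>S. m i))"
  have K: "K \<ge> 0" unfolding K_def by (intro add_nonneg_nonneg sum_nonneg) auto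
  have le: "log_plus (cmod (mpoly_eval k c hs z)) \<le> B * (1 + (\<Sum>i<k. log_plus (cmod (hs i z))))" for z
  proof -
    let ?l = "\<lambda>i. log_plus (cmod (hs i z))"
    have mono: "log_plus (cmod (c m * (\<Prod>i<k. hs i z ^ m i))) \<le> log_plus (cmod (c m)) + (\<Sum>i<k. m i * ?l i)" for m
    proof -
      have "log_plus (\<Prod>i<k. cmod (hs i z) ^ m i) \<le> (\<Sum>i<k. log_plus (cmod (hs i z) ^ m i))"
        by (rule log_plus_prod_le) auto
      also have "\<dots> \<le> (\<Sum>i<k. m i * ?l i)"
        by (intro sum_mono log_plus_power_le) auto
      finally have "log_plus (\<Prod>i<k. cmod (hs i z) ^ m i) \<le> (\<Sum>i<k. m i * ?l i)" .
      moreover have "cmod (c m * (\<Prod>i<k. hs i z ^ m i)) = cmod (c m) * (\<Prod>i<k. cmod (hs i z) ^ m i)"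
        by (simp add: norm_mult norm_power flip: prod_norm)
      ultimately show ?thesis
        using log_plus_mult_le[of "cmod (c m)" "\<Prod>i<k. cmod (hs i z) ^ m i"]
        by (simp add: prod_nonneg)
    qed
    have "cmod (mpoly_eval k c hs z) \<le> (\<Sum>m\<in>S. cmod (c m * (\<Prod>i<k. hs i z ^ m i)))"
      unfolding mpoly_eval_def S_def by (rule norm_sum)
    then have "log_plus (cmod (mpoly_eval k c hs z)) \<le>
      log_plus (card S) + (\<Sum>m\<in>S. log_plus (cmod (c m * (\<Prod>i<k. hs i z ^ m i))))"
      by (rule order_trans[OF log_plus_mono log_plus_sum_le])
    also have "\<dots> \<le> log_plus (card S) + (\<Sum>m\<in>S. log_plus (cmod (c m)) + (\<Sum>i<k. m i * ?l i))"
      by (intro add_left_mono sum_mono mono)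
    also have "\<dots> = K + (\<Sum>i<k. real (\<Sum>m\<in>S. m i) * ?l i)"
      unfolding K_def sum.distrib by (simp add: sum_distrib_right sum.swap[of _ _ S])
    also have "\<dots> \<le> K + (\<Sum>i<k. B * ?l i)"
    proof (intro add_left_mono sum_mono mult_right_mono)
      fix i assume "i \<in> {..<k}"
      then have "real (\<Sum>m\<in>S. m i) \<le> (\<Sum>i<k. real (\<Sum>m\<in>S. m i))"
        by (intro member_le_sum) (auto intro: sum_nonneg)
      then show "real (\<Sum>m\<in>S. m i) \<le> B" unfolding B_def using K by linarith
    qed auto
    also have "K \<le> B" unfolding B_def by (simp add: sum_nonneg)
    finally show ?thesis by (simp add: distrib_left sum_distrib_left)
  qed
  have "B \<ge> 0" unfolding B_def using K by (intro add_nonneg_nonneg sum_nonneg of_nat_0_le_iff)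
  from that[OF this le] show ?thesis .
qed

lemma entire_mpoly_eval:
  assumes "\<And>i. i < k \<Longrightarrow> entire (hs i)"
  shows "entire (mpoly_eval k c hs)"
  unfolding entire_def mpoly_eval_def[abs_def]
  using assms by (intro holomorphic_intros) (auto simp: entire_def)

section \<open>Jensen's inequality and algebraic equations\<close>

text \<open>Jensen's inequality without the counting term. The truncation at \<open>\<delta>\<close> keeps the integrand
  continuous when \<open>a\<close> has zeros on the circle.\<close>

lemma circle_mean_ln_ge:
  assumes a: "entire a" and a0: "a z0 \<noteq> 0"
  obtains B where "\<And>r \<delta>. r \<ge> 1 \<Longrightarrow> \<delta> > 0 \<Longrightarrow> - B \<le> circle_mean (\<lambda>z. ln (max (cmod (a z)) \<delta>)) r"
proof -
  \<comment> \<open>A zero at the origin is divided out so that the value at the centre is nonzero.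
    On circles of radius at least 1 this does not increase the modulus, so the majorant for
    \<open>a\<close> serves for \<open>b\<close>.\<close>
  obtain b n where b: "entire b" "b 0 \<noteq> 0" and ab: "\<And>z. a z = z ^ n * b z"
  proof (cases "a 0 = 0")
    case False
    then show ?thesis using that[of a 0] a by simp
  next
    case True
    have "\<not> a constant_on UNIV" using True a0 unfolding constant_on_def by (metis UNIV_I)
    then obtain g r n where g: "0 < n" "0 < r" "g holomorphic_on ball 0 r"
        "\<And>w. w \<in> ball 0 r \<Longrightarrow> a w = (w - 0) ^ n * g w" "\<And>w. w \<in> ball 0 r \<Longrightarrow> g w \<noteq> 0"
      using holomorphic_factor_zero_nonconstant[of a UNIV 0] a True unfolding entire_def
      by (metis UNIV_I connected_UNIV open_UNIV)
    define b where "b = (\<lambda>w. if w = 0 then g 0 else a w / w ^ n)"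
    have "b holomorphic_on ball 0 r"
      using g by (subst holomorphic_cong[of _ _ b g]) (auto simp: b_def)
    moreover have "b holomorphic_on - {0}"
    proof -
      have "(\<lambda>w. a w / w ^ n) holomorphic_on - {0}"
        by (intro holomorphic_intros entire_holomorphic_on[OF a]) auto
      then show ?thesis by (rule holomorphic_transform) (auto simp: b_def)
    qed
    ultimately have "b holomorphic_on (ball 0 r \<union> - {0})"
      by (intro holomorphic_on_Un) auto
    moreover have "ball 0 r \<union> - {0} = (UNIV :: complex set)" using g by auto
    ultimately have "entire b" unfolding entire_def by simp
    moreover have "b 0 \<noteq> 0" using g by (simp add: b_def)
    moreover have "a z = z ^ n * b z" for z using True g(1) by (simp add: b_def)
    ultimately show ?thesis using that by blast
  qed
  have "ln (cmod (b 0)) \<le> circle_mean (\<lambda>z. ln (max (cmod (a z)) \<delta>)) r" if r: "r \<ge> 1" and d: "\<delta> > 0" for r \<delta>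
  proof -
    have "cmod (b 0) \<le> exp (circle_mean (\<lambda>z. ln (max (cmod (a z)) \<delta>)) r)"
    proof (rule mean_value_majorant[OF entire_holomorphic_on entire_continuous_on])
      show "continuous_on (sphere 0 r) (\<lambda>z. ln (max (cmod (a z)) \<delta>))"
        using d by (intro continuous_on_ln continuous_on_max entire_continuous_norm a continuous_on_const ballI)
          (auto simp: max_def split: if_splits)
      fix z assume z: "cmod z = r"
      have "cmod (b z) \<le> r ^ n * cmod (b z)" using r mult_right_mono[of 1 "r ^ n" "cmod (b z)"] by simp
      also have "\<dots> = cmod (a z)" using z by (simp add: ab norm_mult norm_power)
      finally show "cmod (b z) \<le> exp (ln (max (cmod (a z)) \<delta>))" using d by simp
    qed (use b r in auto)
    then show ?thesis using b by (metis exp_le_cancel_iff exp_ln zero_less_norm_iff)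
  qed
  then show ?thesis using that[of "- ln (cmod (b 0))"] by simp
qed

text \<open>Isolate the top term, replace every lower power of \<open>cmod g\<close> by the
  \<open>(D - 1)\<close>-st, which is larger because \<open>cmod g > 1\<close>, and cancel
  it.\<close>

lemma root_bound:
  fixes A :: "nat \<Rightarrow> complex" and g :: complex
  assumes eq: "(\<Sum>j\<le>D. A j * g ^ j) = 0" and D: "D \<ge> 1" and g: "cmod g > 1"
  shows "cmod (A D) * cmod g \<le> (\<Sum>j<D. cmod (A j))"
proof -
  have "A D * g ^ D = - (\<Sum>j<D. A j * g ^ j)"
    using eq by (simp add: lessThan_Suc_atMost[symmetric] add_eq_0_iff2 add.commute)
  then have "cmod (A D) * cmod g ^ D \<le> (\<Sum>j<D. cmod (A j * g ^ j))"
    by (metis norm_minus_cancel norm_mult norm_power norm_sum)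
  also have "\<dots> \<le> (\<Sum>j<D. cmod (A j) * cmod g ^ (D - 1))"
    by (intro sum_mono) (use g in \<open>auto simp: norm_mult norm_power intro!: mult_left_mono power_increasing\<close>)
  finally have "cmod (A D) * cmod g ^ D \<le> (\<Sum>j<D. cmod (A j)) * cmod g ^ (D - 1)"
    by (simp only: sum_distrib_right)
  moreover have "cmod g ^ D = cmod g * cmod g ^ (D - 1)"
    using D by (cases D) auto
  ultimately have "(cmod (A D) * cmod g) * cmod g ^ (D - 1) \<le> (\<Sum>j<D. cmod (A j)) * cmod g ^ (D - 1)"
    by (simp only: mult.assoc)
  moreover have "cmod g ^ (D - 1) > 0" by (rule zero_less_power) (use g in linarith)
  ultimately show ?thesis by (rule mult_right_le_imp_le)
qed

text \<open>Where \<bar>g\<bar> > 1, \<open>root_bound\<close> gives ln \<bar>g\<bar> \<le> ln D + W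
  - ln \<bar>A D\<bar>. The mean of the last term is bounded above by Jensen's inequality for the
  leading coefficient.\<close>

lemma nev_T_algebraic_le:
  assumes A: "\<And>j. j \<le> D \<Longrightarrow> entire (A j)" and g: "entire g" and D: "D \<ge> 1"
    and W: "continuous_on UNIV W" "\<And>z j. j \<le> D \<Longrightarrow> log_plus (cmod (A j z)) \<le> W z"
    and eq: "\<And>z. (\<Sum>j\<le>D. A j z * g z ^ j) = 0" and nz: "A D z0 \<noteq> 0"
  obtains C where "\<And>r. r \<ge> 1 \<Longrightarrow> nev_T g r \<le> C + circle_mean W r"
proof -
  obtain B where B: "\<And>r \<delta>. r \<ge> 1 \<Longrightarrow> \<delta> > 0 \<Longrightarrow> - B \<le> circle_mean (\<lambda>z. ln (max (cmod (A D z)) \<delta>)) r"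
    using circle_mean_ln_ge[OF A[of D] nz] by auto
  have W0: "W z \<ge> 0" for z using W(2)[of 0 z] log_plus_nonneg order_trans by blast
  have "nev_T g r \<le> ln D + B + circle_mean W r" if r: "r \<ge> 1" for r
  proof -
    \<comment> \<open>Where the leading coefficient is smaller than this \<delta>, the term
      \<open>- L z\<close> alone is \<open>log_plus (max_mod g r)\<close>, hence at least
      \<open>log_plus (cmod (g z))\<close>. That \<delta> depends on \<open>r\<close> is harmless,
      as \<open>B\<close> does not depend on \<delta>.\<close>
    define \<delta> where "\<delta> = exp (- log_plus (max_mod g r))"
    have d: "\<delta> > 0" unfolding \<delta>_def by simp
    define L where "L = (\<lambda>z. ln (max (cmod (A D z)) \<delta>))"
    have contL: "continuous_on UNIV L" unfolding L_def
      using d by (intro continuous_on_ln continuous_on_max entire_continuous_norm A continuous_on_const ballI)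
          (auto simp: max_def split: if_splits)
    have pt: "log_plus (cmod (g z)) \<le> ln D + W z + (-1) * L z" if z: "cmod z = r" for z
    proof (cases "cmod (A D z) \<ge> \<delta>")
      case False
      then have "L z = - log_plus (max_mod g r)" unfolding L_def by (simp add: max_def \<delta>_def)
      moreover have "log_plus (cmod (g z)) \<le> log_plus (max_mod g r)"
        by (intro log_plus_mono norm_le_max_mod g) (use z in auto)
      moreover have "ln D \<ge> 0" using D by simp
      ultimately show ?thesis using W0[of z] by linarith
    next
      case True
      then have L: "L z = ln (cmod (A D z))" and ADpos: "cmod (A D z) > 0"
        unfolding L_def using d by (auto simp: max_def)
      have le: "cmod (A j z) \<le> exp (W z)" if "j \<le> D" for j
        using W(2)[OF that, of z] W0[of z] by (simp add: log_plus_le_iff)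
      have LW: "L z \<le> W z" using le[of D] ADpos L by (metis ln_exp ln_mono order_refl)
      have lnD: "ln D \<ge> 0" using D by simp
      show ?thesis
      proof (cases "cmod (g z) > 1")
        case False
        then have "log_plus (cmod (g z)) = 0" by (simp add: log_plus_def)
        then show ?thesis using LW lnD by simp
      next
        case True
        have "cmod (A D z) * cmod (g z) \<le> (\<Sum>j<D. cmod (A j z))"
          by (rule root_bound[OF eq D True])
        also have "\<dots> \<le> (\<Sum>j<D. exp (W z))" by (intro sum_mono le) auto
        finally have "cmod (A D z) * cmod (g z) \<le> D * exp (W z)" by simp
        then have "ln (cmod (A D z) * cmod (g z)) \<le> ln (D * exp (W z))"
          using ADpos True by (intro ln_mono mult_pos_pos) auto
        then have "ln (cmod (A D z)) + ln (cmod (g z)) \<le> ln D + W z"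
          using ADpos True D by (simp add: ln_mult split: if_splits)
        then show ?thesis using True L by (simp add: log_plus_def)
      qed
    qed
    have "nev_T g r \<le> circle_mean (\<lambda>z. (ln D + W z) + (-1) * L z) r"
      unfolding nev_T_eq_circle_mean
      by (intro circle_mean_mono entire_continuous_log_plus g continuous_intros W contL) (use r pt in auto)
    also have "\<dots> = ln D + circle_mean W r + (-1) * circle_mean L r"
      by (subst circle_mean_add, intro continuous_intros W, intro continuous_intros contL,
          subst circle_mean_add, intro continuous_intros, rule W, subst circle_mean_cmult) simp
    also have "\<dots> \<le> ln D + B + circle_mean W r"
      using B[OF r d] unfolding L_def by simp
    finally show ?thesis .
  qed
  then show ?thesis by (rule that)
qed

text \<open>The polynomial is read as univariate in its last variable \<open>X_k\<close>, with
  \<open>j\<close> the power of \<open>X_k\<close>. The test \<open>m k = 0\<close> makes each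
  coefficient a polynomial in the first \<open>k\<close> variables only.\<close>

definition coeff_last :: "nat \<Rightarrow> ((nat \<Rightarrow> nat) \<Rightarrow> complex) \<Rightarrow> nat \<Rightarrow> (nat \<Rightarrow> nat) \<Rightarrow> complex" where
  "coeff_last k c j m = (if m k = 0 then c (m(k := j)) else 0)"

lemma mpoly_ok_coeff_last:
  assumes "mpoly_ok (Suc k) c"
  shows "mpoly_ok k (coeff_last k c j)"
proof -
  have "{m. coeff_last k c j m \<noteq> 0} \<subseteq> (\<lambda>m. m(k := 0)) ` {m. c m \<noteq> 0}"
  proof
    fix m assume "m \<in> {m. coeff_last k c j m \<noteq> 0}"
    then have m: "m k = 0" "c (m(k := j)) \<noteq> 0" by (auto simp: coeff_last_def split: if_splits)
    have "m = (m(k := j))(k := 0)" using m(1) by (auto simp: fun_eq_iff)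
    then show "m \<in> (\<lambda>m. m(k := 0)) ` {m. c m \<noteq> 0}" using m(2) by blast
  qed
  then have "finite {m. coeff_last k c j m \<noteq> 0}"
    using assms unfolding mpoly_ok_def by (meson finite_imageI finite_subset)
  moreover have "m i = 0" if "coeff_last k c j m \<noteq> 0" "i \<ge> k" for m i
  proof (cases "i = k")
    case False
    then have "(m(k := j)) i = 0"
      using that assms unfolding mpoly_ok_def coeff_last_def by (auto split: if_splits)
    then show ?thesis using False by simp
  qed (use that in \<open>auto simp: coeff_last_def split: if_splits\<close>)
  ultimately show ?thesis unfolding mpoly_ok_def by blast
qed

lemma mpoly_eval_Suc:
  assumes ok: "mpoly_ok (Suc k) c" and D: "\<And>m. c m \<noteq> 0 \<Longrightarrow> m k \<le> D"
  shows "mpoly_eval (Suc k) c hs z = (\<Sum>j\<le>D. mpoly_eval k (coeff_last k c j) hs z * hs k z ^ j)"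
proof -
  define S where "S = {m. c m \<noteq> 0}"
  have fin: "finite S" using ok unfolding S_def mpoly_ok_def by auto
  have "mpoly_eval (Suc k) c hs z = (\<Sum>m\<in>S. c m * (\<Prod>i<k. hs i z ^ m i) * hs k z ^ m k)"
    unfolding mpoly_eval_def S_def by (simp add: mult.assoc)
  also have "\<dots> = (\<Sum>j\<le>D. \<Sum>m | m \<in> S \<and> m k = j. c m * (\<Prod>i<k. hs i z ^ m i) * hs k z ^ m k)"
    by (rule sum.group[symmetric]) (use fin D in \<open>auto simp: S_def\<close>)
  also have "\<dots> = (\<Sum>j\<le>D. mpoly_eval k (coeff_last k c j) hs z * hs k z ^ j)"
  proof (rule sum.cong[OF refl])
    fix j
    show "(\<Sum>m | m \<in> S \<and> m k = j. c m * (\<Prod>i<k. hs i z ^ m i) * hs k z ^ m k) =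
      mpoly_eval k (coeff_last k c j) hs z * hs k z ^ j"
      unfolding mpoly_eval_def sum_distrib_right
      by (rule sum.reindex_bij_witness[where i = "\<lambda>m. m(k := j)" and j = "\<lambda>m. m(k := 0)"])
         (auto simp: S_def coeff_last_def split: if_splits)
  qed
  finally show ?thesis .
qed

text \<open>A relation involving \<open>hs k\<close> has, by independence of the predecessors, a
  leading coefficient that is not identically zero; \<open>nev_T_algebraic_le\<close> then bounds
  \<open>nev_T (hs k)\<close> by the predecessors and contradicts \<open>growth\<close>.\<close>

lemma alg_indep_Suc:
  assumes ind: "alg_indep k hs" and ent: "\<And>i. i \<le> k \<Longrightarrow> entire (hs i)"
    and growth: "\<And>C. \<exists>r\<ge>1. nev_T (hs k) r > C * (1 + (\<Sum>i<k. nev_T (hs i) r))"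
  shows "alg_indep (Suc k) hs"
  unfolding alg_indep_def
proof (intro allI impI)
  fix c mm assume c: "mpoly_ok (Suc k) c \<and> (\<forall>z. mpoly_eval (Suc k) c hs z = 0)"
  define S where "S = {m. c m \<noteq> 0}"
  have fin: "finite S" using c unfolding S_def mpoly_ok_def by auto
  show "c mm = 0"
  proof (rule ccontr)
    assume "c mm \<noteq> 0"
    then have ne: "S \<noteq> {}" unfolding S_def by auto
    define D where "D = Max ((\<lambda>m. m k) ` S)"
    have D: "m k \<le> D" if "c m \<noteq> 0" for m
      unfolding D_def using that fin by (intro Max_ge) (auto simp: S_def)
    have "D \<in> (\<lambda>m. m k) ` S" unfolding D_def using fin ne by (intro Max_in) auto
    then obtain m where m: "c m \<noteq> 0" "m k = D" unfolding S_def by auto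
    define A where "A = (\<lambda>j. mpoly_eval k (coeff_last k c j) hs)"
    have eq: "(\<Sum>j\<le>D. A j z * hs k z ^ j) = 0" for z
      using mpoly_eval_Suc[of k c D hs z] c D unfolding A_def by simp
    have "coeff_last k c D (m(k := 0)) \<noteq> 0" using m by (auto simp: coeff_last_def)
    then obtain z0 where z0: "A D z0 \<noteq> 0"
      using ind mpoly_ok_coeff_last[of k c D] c unfolding alg_indep_def A_def by blast
    \<comment> \<open>For \<open>D = 0\<close> the relation would say that \<open>A 0\<close>
      vanishes at \<open>z0\<close>.\<close>
    then have D1: "D \<ge> 1" using eq[of z0] by (cases D) auto
    have "\<forall>j. \<exists>B\<ge>0. \<forall>z. log_plus (cmod (A j z)) \<le> B * (1 + (\<Sum>i<k. log_plus (cmod (hs i z))))"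
      unfolding A_def by (metis log_plus_mpoly_eval_le)
    then obtain B where B: "\<And>j. B j \<ge> 0"
      "\<And>j z. log_plus (cmod (A j z)) \<le> B j * (1 + (\<Sum>i<k. log_plus (cmod (hs i z))))" by metis
    define B' where "B' = (\<Sum>j\<le>D. B j)"
    define W where "W = (\<lambda>z. B' * (1 + (\<Sum>i<k. log_plus (cmod (hs i z)))))"
    have contW: "continuous_on UNIV W" unfolding W_def
      by (intro continuous_on_mult continuous_on_const continuous_on_add continuous_on_sum
          entire_continuous_log_plus ent) auto
    obtain C where C: "\<And>r. r \<ge> 1 \<Longrightarrow> nev_T (hs k) r \<le> C + circle_mean W r"
    proof (rule nev_T_algebraic_le[where A = A and g = "hs k" and W = W, OF _ _ D1 contW _ eq z0])
      show "entire (A j)" for j unfolding A_def by (rule entire_mpoly_eval) (use ent in auto)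
      show "log_plus (cmod (A j z)) \<le> W z" if "j \<le> D" for j z
      proof -
        have "B j \<le> B'" unfolding B'_def by (rule member_le_sum) (use that B in auto)
        then show ?thesis unfolding W_def
          by (intro order_trans[OF B(2)] mult_right_mono) (auto intro!: add_nonneg_nonneg sum_nonneg)
      qed
    qed (use ent in auto)
    have W: "circle_mean W r = B' * (1 + (\<Sum>i<k. nev_T (hs i) r))" for r
      unfolding W_def circle_mean_cmult nev_T_eq_circle_mean
      by (subst circle_mean_add)
         (auto intro!: continuous_on_sum entire_continuous_log_plus ent circle_mean_sum)
    \<comment> \<open>The factor \<open>\<bar>C\<bar> + B'\<close> beats the additive and the
      multiplicative constant at once, because the bracket is at least 1.\<close>
    obtain r where r: "r \<ge> 1" "nev_T (hs k) r > (\<bar>C\<bar> + B') * (1 + (\<Sum>i<k. nev_T (hs i) r))"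
      using growth by blast
    have "0 \<le> (\<Sum>i<k. nev_T (hs i) r)" by (intro sum_nonneg) auto
    then have "C \<le> \<bar>C\<bar> * (1 + (\<Sum>i<k. nev_T (hs i) r))"
      using mult_left_mono[of 1 "1 + (\<Sum>i<k. nev_T (hs i) r)" "\<bar>C\<bar>"] by simp
    then show False using C[OF r(1)] r(2) W[of r] by (simp add: distrib_right)
  qed
qed

lemma alg_indep_0: "alg_indep 0 hs"
  unfolding alg_indep_def
proof (intro allI impI)
  fix c :: "(nat \<Rightarrow> nat) \<Rightarrow> complex" and mm
  assume c: "mpoly_ok 0 c \<and> (\<forall>z. mpoly_eval 0 c hs z = 0)"
  then have sub: "{m. c m \<noteq> 0} \<subseteq> {\<lambda>_. 0}" unfolding mpoly_ok_def by auto
  show "c mm = 0"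
  proof (rule ccontr)
    assume "c mm \<noteq> 0"
    then have "mm = (\<lambda>_. 0)" "{m. c m \<noteq> 0} = {mm}" using sub by auto
    then have "mpoly_eval 0 c hs 0 = c mm" unfolding mpoly_eval_def by simp
    then show False using c \<open>c mm \<noteq> 0\<close> by simp
  qed
qed

section \<open>Transcendence degree of generated algebras\<close>

text \<open>Gaussian elimination by induction on the equations: a zero row is dropped, and otherwise
  a pivot removes one equation together with one unknown. Arbitrary finite index sets are allowed
  because exponent vectors will index both sides.\<close>

lemma underdetermined_system:
  fixes M :: "'b \<Rightarrow> 'a \<Rightarrow> 'k::field"
  assumes "finite B" "finite A" "card B < card A"
  obtains x where "\<exists>a\<in>A. x a \<noteq> 0" "\<And>b. b \<in> B \<Longrightarrow> (\<Sum>a\<in>A. M b a * x a) = 0"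
proof -
  have "\<exists>x. (\<exists>a\<in>A. x a \<noteq> 0) \<and> (\<forall>b\<in>B. (\<Sum>a\<in>A. M b a * x a) = 0)"
    using assms
  proof (induction B arbitrary: A M rule: finite_induct)
    case empty
    then obtain a where "a \<in> A" by (metis card_gt_0_iff card.empty ex_in_conv)
    then show ?case by (intro exI[of _ "\<lambda>_. 1"]) auto
  next
    case (insert b B)
    show ?case
    proof (cases "\<forall>a\<in>A. M b a = 0")
      case True
      have "\<exists>x. (\<exists>a\<in>A. x a \<noteq> 0) \<and> (\<forall>b\<in>B. (\<Sum>a\<in>A. M b a * x a) = 0)"
        by (rule insert.IH) (use insert.prems insert.hyps in auto)
      then show ?thesis using True by auto
    next
      case False
      then obtain p where p: "p \<in> A" "M b p \<noteq> 0" by auto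
      define M' where "M' = (\<lambda>b' a. M b' a - M b' p * M b a / M b p)"
      have "\<exists>x. (\<exists>a\<in>A - {p}. x a \<noteq> 0) \<and> (\<forall>b'\<in>B. (\<Sum>a\<in>A - {p}. M' b' a * x a) = 0)"
        by (rule insert.IH) (use insert.prems insert.hyps p in auto)
      then obtain x where x: "\<exists>a\<in>A - {p}. x a \<noteq> 0" "\<And>b'. b' \<in> B \<Longrightarrow> (\<Sum>a\<in>A - {p}. M' b' a * x a) = 0"
        by auto
      define s where "s = (\<Sum>a\<in>A - {p}. M b a * x a)"
      define y where "y = x(p := - s / M b p)"
      have eq: "(\<Sum>a\<in>A. M b' a * y a) = (\<Sum>a\<in>A - {p}. M b' a * x a) - M b' p * s / M b p" for b'
      proof -
        have "(\<Sum>a\<in>A. M b' a * y a) = M b' p * y p + (\<Sum>a\<in>A - {p}. M b' a * y a)"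
          using insert.prems p by (intro sum.remove) auto
        also have "(\<Sum>a\<in>A - {p}. M b' a * y a) = (\<Sum>a\<in>A - {p}. M b' a * x a)"
          by (rule sum.cong) (auto simp: y_def)
        finally show ?thesis by (simp add: y_def)
      qed
      have "(\<Sum>a\<in>A. M b a * y a) = 0" using p by (simp add: eq) (simp add: s_def)
      moreover have "(\<Sum>a\<in>A. M b' a * y a) = 0" if "b' \<in> B" for b'
      proof -
        have "(\<Sum>a\<in>A - {p}. M' b' a * x a) = (\<Sum>a\<in>A - {p}. M b' a * x a) - M b' p * s / M b p"
          unfolding M'_def s_def sum_distrib_left sum_divide_distrib sum_subtractf[symmetric]
          by (rule sum.cong) (simp_all add: algebra_simps)
        then show ?thesis using x(2)[OF that] eq[of b'] by simp
      qed
      moreover have "\<exists>a\<in>A. y a \<noteq> 0" using x(1) by (auto simp: y_def)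
      ultimately show ?thesis by (intro exI[of _ y]) auto
    qed
  qed
  then show ?thesis using that by blast
qed

text \<open>Entries from \<open>k\<close> on are fixed to 0, as in \<open>mpoly_ok\<close>, so that
  the box is a finite set of functions.\<close>

definition exp_box :: "nat \<Rightarrow> nat \<Rightarrow> (nat \<Rightarrow> nat) set" where
  "exp_box k N = {m. (\<forall>i<k. m i \<le> N) \<and> (\<forall>i\<ge>k. m i = 0)}"

lemma exp_box_Suc: "exp_box (Suc k) N = (\<lambda>(m, j). m(k := j)) ` (exp_box k N \<times> {..N})"
proof
  show "exp_box (Suc k) N \<subseteq> (\<lambda>(m, j). m(k := j)) ` (exp_box k N \<times> {..N})"
  proof
    fix m assume m: "m \<in> exp_box (Suc k) N"
    then have "m(k := 0) \<in> exp_box k N" "m k \<le> N" by (auto simp: exp_box_def)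
    moreover have "m = (\<lambda>(m, j). m(k := j)) (m(k := 0), m k)" by auto
    ultimately show "m \<in> (\<lambda>(m, j). m(k := j)) ` (exp_box k N \<times> {..N})" by blast
  qed
qed (auto simp: exp_box_def less_Suc_eq)

lemma finite_exp_box: "finite (exp_box k N)"
  and card_exp_box: "card (exp_box k N) = (N + 1) ^ k"
proof (induction k)
  case 0
  have "exp_box 0 N = {\<lambda>_. 0}" by (auto simp: exp_box_def)
  then show "finite (exp_box 0 N)" "card (exp_box 0 N) = (N + 1) ^ 0" by auto
next
  case (Suc k)
  show "finite (exp_box (Suc k) N)" unfolding exp_box_Suc using Suc by auto
  have "inj_on (\<lambda>(m, j). m(k := j)) (exp_box k N \<times> {..N})"
  proof (rule inj_onI, clarify)
    fix m j m' j' assume "m \<in> exp_box k N" "m' \<in> exp_box k N" "m(k := j) = m'(k := j')"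
    then show "m = m' \<and> j = j'"
      by (auto simp: exp_box_def fun_eq_iff) (metis le_refl)+
  qed
  then show "card (exp_box (Suc k) N) = (N + 1) ^ Suc k"
    unfolding exp_box_Suc using Suc by (simp add: card_image card_cartesian_product)
qed

text \<open>A filtration of the generated algebra by the degree in each generator separately; boxes
  are chosen because they have exactly \<open>(N + 1) ^ k\<close> monomials.\<close>

definition gen_box :: "nat \<Rightarrow> (nat \<Rightarrow> complex \<Rightarrow> complex) \<Rightarrow> nat \<Rightarrow> (complex \<Rightarrow> complex) set" where
  "gen_box k gs N = {\<phi>. \<exists>M. \<forall>z. \<phi> z = (\<Sum>m\<in>exp_box k N. M m * (\<Prod>i<k. gs i z ^ m i))}"

lemma gen_box_monom:
  assumes "m \<in> exp_box k N"
  shows "(\<lambda>z. a * (\<Prod>i<k. gs i z ^ m i)) \<in> gen_box k gs N"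
proof -
  have "(\<Sum>m'\<in>exp_box k N. (if m' = m then a else 0) * (\<Prod>i<k. gs i z ^ m' i)) = a * (\<Prod>i<k. gs i z ^ m i)" for z
  proof -
    have "(\<Sum>m'\<in>exp_box k N. (if m' = m then a else 0) * (\<Prod>i<k. gs i z ^ m' i)) =
      (\<Sum>m'\<in>exp_box k N. if m' = m then a * (\<Prod>i<k. gs i z ^ m' i) else 0)"
      by (rule sum.cong) auto
    then show ?thesis using assms finite_exp_box by simp
  qed
  then show ?thesis unfolding gen_box_def by (intro CollectI exI[of _ "\<lambda>m'. if m' = m then a else 0"]) simp
qed

lemma gen_box_0: "(\<lambda>z. 0) \<in> gen_box k gs N"
  unfolding gen_box_def by (intro CollectI exI[of _ "\<lambda>_. 0"]) simp

lemma gen_box_add: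
  assumes "\<phi> \<in> gen_box k gs N" "\<psi> \<in> gen_box k gs N"
  shows "(\<lambda>z. \<phi> z + \<psi> z) \<in> gen_box k gs N"
proof -
  obtain M M' where "\<And>z. \<phi> z = (\<Sum>m\<in>exp_box k N. M m * (\<Prod>i<k. gs i z ^ m i))"
      "\<And>z. \<psi> z = (\<Sum>m\<in>exp_box k N. M' m * (\<Prod>i<k. gs i z ^ m i))"
    using assms unfolding gen_box_def by blast
  then show ?thesis unfolding gen_box_def
    by (intro CollectI exI[of _ "\<lambda>m. M m + M' m"]) (simp add: distrib_right sum.distrib)
qed

lemma gen_box_sum:
  assumes "\<And>a. a \<in> A \<Longrightarrow> \<phi> a \<in> gen_box k gs N"
  shows "(\<lambda>z. \<Sum>a\<in>A. \<phi> a z) \<in> gen_box k gs N"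
  using assms by (induction A rule: infinite_finite_induct) (auto intro: gen_box_0 gen_box_add)

lemma gen_box_mono:
  assumes "\<phi> \<in> gen_box k gs N" "N \<le> N'"
  shows "\<phi> \<in> gen_box k gs N'"
proof -
  obtain M where M: "\<And>z. \<phi> z = (\<Sum>m\<in>exp_box k N. M m * (\<Prod>i<k. gs i z ^ m i))"
    using assms unfolding gen_box_def by blast
  have "exp_box k N \<subseteq> exp_box k N'" using assms(2) by (auto simp: exp_box_def)
  then have "(\<lambda>z. \<Sum>m\<in>exp_box k N. M m * (\<Prod>i<k. gs i z ^ m i)) \<in> gen_box k gs N'"
    by (intro gen_box_sum gen_box_monom) auto
  moreover have "\<phi> = (\<lambda>z. \<Sum>m\<in>exp_box k N. M m * (\<Prod>i<k. gs i z ^ m i))" using M by (rule ext)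
  ultimately show ?thesis by simp
qed

lemma gen_box_mult:
  assumes "\<phi> \<in> gen_box k gs N" "\<psi> \<in> gen_box k gs N'"
  shows "(\<lambda>z. \<phi> z * \<psi> z) \<in> gen_box k gs (N + N')"
proof -
  obtain M M' where M: "\<And>z. \<phi> z = (\<Sum>m\<in>exp_box k N. M m * (\<Prod>i<k. gs i z ^ m i))"
      "\<And>z. \<psi> z = (\<Sum>m\<in>exp_box k N'. M' m * (\<Prod>i<k. gs i z ^ m i))"
    using assms unfolding gen_box_def by blast
  have "(\<lambda>z. \<Sum>m\<in>exp_box k N. \<Sum>m'\<in>exp_box k N'.
      (M m * M' m') * (\<Prod>i<k. gs i z ^ (m i + m' i))) \<in> gen_box k gs (N + N')"
    by (intro gen_box_sum gen_box_monom[where m = "\<lambda>i. _ i + _ i"]) (auto simp: exp_box_def add_mono)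
  moreover have "(\<lambda>z. \<phi> z * \<psi> z) = (\<lambda>z. \<Sum>m\<in>exp_box k N. \<Sum>m'\<in>exp_box k N'.
      (M m * M' m') * (\<Prod>i<k. gs i z ^ (m i + m' i)))"
    unfolding M sum_product power_add prod.distrib by (intro ext sum.cong refl) (simp only: mult_ac)
  ultimately show ?thesis by simp
qed

lemma gen_box_1: "(\<lambda>z. 1) \<in> gen_box k gs 0"
  using gen_box_monom[of "\<lambda>_. 0" k 0 1 gs] by (simp add: exp_box_def)

lemma gen_box_power:
  assumes "\<phi> \<in> gen_box k gs N"
  shows "(\<lambda>z. \<phi> z ^ p) \<in> gen_box k gs (p * N)"
proof (induction p)
  case (Suc p)
  from gen_box_mult[OF assms Suc] show ?case by simp
qed (simp add: gen_box_1)

lemma gen_box_prod: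
  assumes "\<And>i. i < n \<Longrightarrow> \<phi> i \<in> gen_box k gs N"
  shows "(\<lambda>z. \<Prod>i<n. \<phi> i z) \<in> gen_box k gs (n * N)"
  using assms
proof (induction n)
  case (Suc n)
  from gen_box_mult[OF Suc.IH Suc.prems[of n]] Suc.prems show ?case by (simp add: add.commute)
qed (simp add: gen_box_1)

lemma gen_algebra_imp_gen_box:
  assumes "\<phi> \<in> gen_algebra k gs"
  obtains N where "\<phi> \<in> gen_box k gs N"
proof -
  obtain c where c: "mpoly_ok k c" and phi: "\<phi> = (\<lambda>z. mpoly_eval k c gs z)"
    using assms unfolding gen_algebra_def by blast
  define S where "S = {m. c m \<noteq> 0}"
  have fin: "finite S" using c unfolding mpoly_ok_def S_def by blast
  define N where "N = (\<Sum>m\<in>S. \<Sum>i<k. m i)"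
  have "m \<in> exp_box k N" if m: "m \<in> S" for m
  proof -
    have "m i \<le> N" if "i < k" for i
    proof -
      have "m i \<le> (\<Sum>i<k. m i)" by (rule member_le_sum) (use that in auto)
      also have "\<dots> \<le> N" unfolding N_def
        by (rule member_le_sum[of m S "\<lambda>m. \<Sum>i<k. m i"]) (use m fin in auto)
      finally show ?thesis .
    qed
    then show ?thesis using c m unfolding exp_box_def mpoly_ok_def S_def by auto
  qed
  then have "(\<lambda>z. \<Sum>m\<in>S. c m * (\<Prod>i<k. gs i z ^ m i)) \<in> gen_box k gs N"
    by (intro gen_box_sum gen_box_monom)
  then show ?thesis using that unfolding phi mpoly_eval_def S_def by blast
qed

text \<open>There are more monomials of bounded degree in \<open>m > k\<close> elements of the algebra than in its
  \<open>k\<close> generators, so the former are linearly dependent.\<close>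

lemma alg_indep_gen_algebra_le:
  assumes hs: "\<And>i. i < m \<Longrightarrow> hs i \<in> gen_algebra k gs" and ind: "alg_indep m hs"
  shows "m \<le> k"
proof (rule ccontr)
  assume "\<not> m \<le> k"
  then have mk: "m > k" by simp
  have "\<forall>i. \<exists>N. i < m \<longrightarrow> hs i \<in> gen_box k gs N" using gen_algebra_imp_gen_box hs by metis
  then obtain N where N: "\<And>i. i < m \<Longrightarrow> hs i \<in> gen_box k gs (N i)" by metis
  define N0 where "N0 = (\<Sum>i<m. N i)"
  have N0: "hs i \<in> gen_box k gs N0" if "i < m" for i
    by (rule gen_box_mono[OF N[OF that]]) (use that in \<open>auto simp: N0_def intro: member_le_sum\<close>)
  \<comment> \<open>Monomials in \<open>hs\<close> with exponents up to \<open>L\<close> lie in the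
    box \<open>N1\<close>, and \<open>N1 + 1 \<le> Q * (L + 1)\<close>. Taking
    \<open>L = Q ^ k\<close> gives \<open>(N1 + 1) ^ k \<le> L * (L + 1) ^ k\<close>, which is below
    \<open>(L + 1) ^ Suc k\<close>.\<close>
  define Q where "Q = m * N0 + 1"
  define L where "L = Q ^ k"
  define N1 where "N1 = m * (L * N0)"
  have "(\<lambda>z. \<Prod>i<m. hs i z ^ e i) \<in> gen_box k gs N1" if "e \<in> exp_box m L" for e
    unfolding N1_def
  proof (rule gen_box_prod)
    fix i assume i: "i < m"
    have "e i \<le> L" using that i by (auto simp: exp_box_def)
    then show "(\<lambda>z. hs i z ^ e i) \<in> gen_box k gs (L * N0)"
      by (intro gen_box_mono[OF gen_box_power[OF N0[OF i]]]) simp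
  qed
  then have "\<forall>e. \<exists>M. e \<in> exp_box m L \<longrightarrow>
      (\<forall>z. (\<Prod>i<m. hs i z ^ e i) = (\<Sum>b\<in>exp_box k N1. M b * (\<Prod>i<k. gs i z ^ b i)))"
    unfolding gen_box_def by blast
  from choice[OF this] obtain M where M: "\<And>e z. e \<in> exp_box m L \<Longrightarrow>
      (\<Prod>i<m. hs i z ^ e i) = (\<Sum>b\<in>exp_box k N1. M e b * (\<Prod>i<k. gs i z ^ b i))"
    by blast
  have "card (exp_box k N1) < card (exp_box m L)"
  proof -
    have "N1 + 1 \<le> Q * (L + 1)" unfolding N1_def Q_def by (simp add: algebra_simps)
    then have "(N1 + 1) ^ k \<le> (Q * (L + 1)) ^ k" by (rule power_mono) simp
    also have "\<dots> = L * (L + 1) ^ k" unfolding power_mult_distrib L_def ..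
    also have "\<dots> < (L + 1) ^ Suc k" by simp
    also have "\<dots> \<le> (L + 1) ^ m" by (rule power_increasing) (use mk in auto)
    finally show ?thesis by (simp add: card_exp_box)
  qed
  then obtain x where x: "\<exists>e\<in>exp_box m L. x e \<noteq> 0"
      "\<And>b. b \<in> exp_box k N1 \<Longrightarrow> (\<Sum>e\<in>exp_box m L. M e b * x e) = 0"
    using underdetermined_system[of "exp_box k N1" "exp_box m L" "\<lambda>b e. M e b"] finite_exp_box by metis
  \<comment> \<open>The solution of the linear system supplies the coefficients of a nontrivial
    relation among the \<open>hs\<close>.\<close>
  define c where "c = (\<lambda>e. if e \<in> exp_box m L then x e else 0)"
  have sub: "{e. c e \<noteq> 0} \<subseteq> exp_box m L" unfolding c_def by auto
  have ok: "mpoly_ok m c" unfolding mpoly_ok_def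
    using finite_subset[OF sub finite_exp_box] sub by (auto simp: exp_box_def)
  have "mpoly_eval m c hs z = 0" for z
  proof -
    have "mpoly_eval m c hs z = (\<Sum>e\<in>exp_box m L. x e * (\<Prod>i<m. hs i z ^ e i))"
      unfolding mpoly_eval_def
      by (rule sum.mono_neutral_cong_left[OF finite_exp_box sub]) (auto simp: c_def)
    also have "\<dots> = (\<Sum>e\<in>exp_box m L. \<Sum>b\<in>exp_box k N1. M e b * x e * (\<Prod>i<k. gs i z ^ b i))"
      by (rule sum.cong) (auto simp: M sum_distrib_left mult_ac)
    also have "\<dots> = (\<Sum>b\<in>exp_box k N1. (\<Sum>e\<in>exp_box m L. M e b * x e) * (\<Prod>i<k. gs i z ^ b i))"
      by (subst sum.swap) (simp add: sum_distrib_right)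
    also have "\<dots> = 0" using x(2) by simp
    finally show ?thesis .
  qed
  then have "c e = 0" for e using ind ok unfolding alg_indep_def by blast
  then show False using x(1) by (auto simp: c_def split: if_splits) metis
qed

lemma generator_in_gen_algebra:
  assumes "j < k"
  shows "gs j \<in> gen_algebra k gs"
proof -
  define e where "e = (\<lambda>i. if i = j then 1 else 0 :: nat)"
  define c where "c = (\<lambda>m. if m = e then 1 else 0 :: complex)"
  have S: "{m. c m \<noteq> 0} = {e}" by (auto simp: c_def)
  have "mpoly_ok k c" unfolding mpoly_ok_def S using assms by (auto simp: c_def e_def split: if_splits)
  moreover have "mpoly_eval k c gs z = gs j z" for z
  proof -
    have "(\<Prod>i<k. gs i z ^ e i) = (\<Prod>i<k. if i = j then gs i z else 1)"
      by (rule prod.cong) (auto simp: e_def)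
    also have "\<dots> = gs j z" using assms by simp
    finally show ?thesis unfolding mpoly_eval_def S by (simp add: c_def)
  qed
  ultimately show ?thesis unfolding gen_algebra_def by (intro CollectI exI[of _ c]) auto
qed

text \<open>The generators themselves attain the supremum, and counting monomials shows that no
  independent family in the algebra is longer.\<close>

lemma trdeg_eq_of_alg_indep:
  assumes "alg_indep k gs"
  shows "trdeg k gs = enat k"
  unfolding trdeg_def
proof (rule antisym)
  show "Sup {enat m |m. \<exists>hs. (\<forall>i<m. hs i \<in> gen_algebra k gs) \<and> alg_indep m hs} \<le> enat k"
  proof (rule Sup_least)
    fix x assume "x \<in> {enat m |m. \<exists>hs. (\<forall>i<m. hs i \<in> gen_algebra k gs) \<and> alg_indep m hs}"
    then obtain m hs where "x = enat m" "\<And>i. i < m \<Longrightarrow> hs i \<in> gen_algebra k gs" "alg_indep m hs" by blast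
    then show "x \<le> enat k" using alg_indep_gen_algebra_le[of m hs k gs] by simp
  qed
  show "enat k \<le> Sup {enat m |m. \<exists>hs. (\<forall>i<m. hs i \<in> gen_algebra k gs) \<and> alg_indep m hs}"
    by (rule Sup_upper) (use assms generator_in_gen_algebra in blast)
qed

section \<open>Comparison of growth\<close>

text \<open>If \<open>L\<close> gained the factor K = 32^(4\<rho>+1) at each of the radii s, 32 s,
  32^2 s, ... up to s^2, it would outgrow r^\<rho>: after \<open>J\<close> steps the radius is below
  32^(2J+1), whereas K^J = 32^((4\<rho>+1)J).\<close>

lemma doubling_radius:
  fixes L :: "real \<Rightarrow> real" and \<rho> :: nat
  assumes bound: "\<And>r. r \<ge> s \<Longrightarrow> L r \<le> r ^ \<rho>" and one: "L s \<ge> 1" and s: "s \<ge> 32"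
  obtains r where "s \<le> r" "r \<le> s\<^sup>2" "L (32 * r) \<le> 32 ^ (4 * \<rho> + 1) * L r"
proof (rule ccontr)
  assume neg: "\<not> thesis"
  define K :: real where "K = 32 ^ (4 * \<rho> + 1)"
  have K: "K > 0" unfolding K_def by simp
  have grow: "L (32 * r) > K * L r" if "s \<le> r" "r \<le> s\<^sup>2" for r
    using neg that \<open>\<And>r. _ \<Longrightarrow> _ \<Longrightarrow> _ \<Longrightarrow> thesis\<close> unfolding K_def by force
  \<comment> \<open>\<open>J\<close> is the largest exponent with 32^J \<le> s, so that all radii
    used stay below s^2; \<open>J \<ge> 1\<close> comes from \<open>s \<ge> 32\<close>.\<close>
  obtain J where J: "32 ^ J \<le> s" "s < 32 ^ Suc J" "J \<ge> 1"
  proof -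
    have ex: "\<exists>k. s < 32 ^ k" using real_arch_pow[of 32 s] by auto
    define k where "k = (LEAST k. s < 32 ^ k)"
    have k: "s < 32 ^ k" unfolding k_def by (rule LeastI_ex[OF ex])
    obtain J where J: "k = Suc J" using k s by (cases k) auto
    have "\<not> s < 32 ^ J" using not_less_Least[of J "\<lambda>k. s < 32 ^ k"] J unfolding k_def by auto
    moreover have "J \<ge> 1" using k s J by (cases J) auto
    ultimately show ?thesis using that[of J] k J by simp
  qed
  have low: "j \<le> J \<Longrightarrow> K ^ j \<le> L (32 ^ j * s)" for j
  proof (induction j)
    case (Suc j)
    have p: "(32::real) ^ j \<le> 32 ^ J" using Suc.prems by (intro power_increasing) auto
    have "1 * s \<le> 32 ^ j * s" using s by (intro mult_right_mono) auto
    moreover have "32 ^ j * s \<le> s\<^sup>2" unfolding power2_eq_square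
      by (rule mult_right_mono[OF order_trans[OF p J(1)]]) (use s in auto)
    ultimately have "K * L (32 ^ j * s) < L (32 * (32 ^ j * s))" by (intro grow) auto
    moreover have "K * K ^ j \<le> K * L (32 ^ j * s)"
      using Suc K by (intro mult_left_mono) auto
    ultimately show ?case by (simp add: mult.assoc)
  qed (use one in auto)
  have "1 * s \<le> 32 ^ J * s" using s by (intro mult_right_mono) auto
  then have "L (32 ^ J * s) \<le> (32 ^ J * s) ^ \<rho>" by (intro bound) simp
  then have "K ^ J \<le> (32 ^ J * s) ^ \<rho>" using low[of J] by simp
  also have "\<dots> \<le> (32 ^ J * 32 ^ Suc J) ^ \<rho>"
    by (intro power_mono mult_left_mono) (use J s in auto)
  also have "\<dots> = 32 ^ ((J + Suc J) * \<rho>)" by (simp only: power_add[symmetric] power_mult[symmetric])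
  finally have "(32::real) ^ ((4 * \<rho> + 1) * J) \<le> 32 ^ ((J + Suc J) * \<rho>)"
    unfolding K_def by (simp only: power_mult[symmetric])
  then have "(4 * \<rho> + 1) * J \<le> (J + Suc J) * \<rho>" by (subst (asm) power_increasing_iff) auto
  also have "\<dots> \<le> (3 * J) * \<rho>" by (rule mult_right_mono) (use J in auto)
  finally show False using J by (simp add: algebra_simps)
qed

section \<open>Order as explicit growth bounds\<close>

lemma finite_order_bound:
  assumes "nev_order f < \<infinity>"
  obtains \<rho> :: nat where "\<forall>\<^sub>F r in at_top. nev_T f r \<le> r ^ \<rho>"
proof -
  obtain \<rho> :: nat where "nev_order f < ereal (real \<rho>)"
    using assms less_PInf_Ex_of_nat[of "nev_order f"] by auto
  then have "\<forall>\<^sub>F r in at_top. ereal (ln (nev_T f r) / ln r) < ereal (real \<rho>)"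
    unfolding nev_order_def by (rule Limsup_lessD)
  then have "\<forall>\<^sub>F r in at_top. nev_T f r \<le> r ^ \<rho>"
    using eventually_gt_at_top[of 1]
  proof eventually_elim
    case (elim r)
    show ?case
    proof (cases "nev_T f r = 0")
      case False
      then have T: "nev_T f r > 0" using nev_T_nonneg[of f r] by linarith
      have "ln (nev_T f r) < \<rho> * ln r" using elim by (simp add: divide_less_eq)
      also have "\<dots> = ln (r ^ \<rho>)" using elim by (simp add: ln_realpow)
      finally show ?thesis using T elim by simp
    qed (use elim in simp)
  qed
  then show ?thesis using that by blast
qed

text \<open>\<delta> is chosen strictly between 0 and the order. A limit superior yields the bound
  only at arbitrarily large \<open>R\<close>, not at all large ones; passing to the maximum modulus
  makes it usable at larger radii by monotonicity.\<close>

lemma positive_order_bound: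
  assumes "nev_order F > 0" "entire F"
  obtains \<delta> where "\<delta> > 0" "\<And>x. \<exists>R\<ge>x. R powr \<delta> \<le> log_plus (max_mod F R)"
proof -
  obtain \<delta> where d: "0 < ereal \<delta>" "ereal \<delta> < nev_order F"
    using ereal_dense2[OF assms(1)] by auto
  have "\<exists>R\<ge>x. R powr \<delta> \<le> log_plus (max_mod F R)" for x
  proof -
    have "\<not> (\<forall>\<^sub>F r in at_top. ereal (ln (nev_T F r) / ln r) \<le> ereal \<delta>)"
      using Limsup_bounded[of "\<lambda>r. ereal (ln (nev_T F r) / ln r)" "ereal \<delta>" at_top] d(2)
      unfolding nev_order_def by auto
    then have "\<exists>R\<ge>max x 2. \<not> ereal (ln (nev_T F R) / ln R) \<le> ereal \<delta>"
      unfolding eventually_at_top_linorder by metis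
    then obtain R where R: "R \<ge> x" "R \<ge> 2" "ln (nev_T F R) / ln R > \<delta>" by auto
    then have l: "ln (nev_T F R) > \<delta> * ln R" by (simp add: less_divide_eq)
    moreover have "\<delta> * ln R > 0" using d R by simp
    \<comment> \<open>The convention \<open>ln 0 = 0\<close> rules out the value 0.\<close>
    ultimately have T: "nev_T F R > 0" using nev_T_nonneg[of F R] by (metis ln_0 less_asym order_less_le)
    have "R powr \<delta> = exp (\<delta> * ln R)" using R by (simp add: powr_def)
    also have "\<dots> \<le> nev_T F R" using l T by (metis exp_le_cancel_iff exp_ln less_imp_le)
    also have "\<dots> \<le> log_plus (max_mod F R)" using R by (intro nev_T_le_log_plus_max_mod assms) auto
    finally show ?thesis using R by blast
  qed
  then show ?thesis using that d by auto
qed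

text \<open>The exceptional set is a parameter rather than bound by an existential, so that several
  relations can share one set and be chained.\<close>

definition small_off :: "real set \<Rightarrow> (complex \<Rightarrow> complex) \<Rightarrow> (complex \<Rightarrow> complex) \<Rightarrow> bool" where
  "small_off E h g \<longleftrightarrow> (\<forall>\<epsilon>>0. \<forall>\<^sub>F r in at_top. r \<notin> E \<longrightarrow> nev_T h r \<le> \<epsilon> * nev_T g r)"

lemma small_wrt_imp_small_off:
  assumes "small_wrt (nev_T h) g"
  obtains E where "E \<in> lmeasurable" "small_off E h g"
proof -
  obtain E where E: "E \<in> lmeasurable" "nev_T h \<in> o[inf at_top (principal (- E))](nev_T g)"
    using assms unfolding small_wrt_def by blast
  have "small_off E h g" unfolding small_off_def
    using landau_o.smallD[OF E(2)] by (simp add: eventually_inf_principal)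
  then show ?thesis using that E by blast
qed

lemma small_off_trans:
  assumes "small_off E h g" "small_off E g u"
  shows "small_off E h u"
  unfolding small_off_def
proof (intro allI impI)
  fix \<epsilon> :: real assume e: "\<epsilon> > 0"
  have "\<forall>\<^sub>F r in at_top. r \<notin> E \<longrightarrow> nev_T h r \<le> 1 * nev_T g r"
    using assms(1) unfolding small_off_def by (meson zero_less_one)
  moreover have "\<forall>\<^sub>F r in at_top. r \<notin> E \<longrightarrow> nev_T g r \<le> \<epsilon> * nev_T u r"
    using assms(2) e unfolding small_off_def by blast
  ultimately show "\<forall>\<^sub>F r in at_top. r \<notin> E \<longrightarrow> nev_T h r \<le> \<epsilon> * nev_T u r"
    by eventually_elim auto
qed

lemma small_off_subset: "small_off E h g \<Longrightarrow> E \<subseteq> E' \<Longrightarrow> small_off E' h g"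
  unfolding small_off_def by (erule all_forward, erule imp_forward, assumption, erule eventually_mono) auto

lemma exists_outside_lmeasurable:
  fixes E :: "real set"
  assumes "E \<in> lmeasurable" "b - a > measure lebesgue E"
  obtains x where "x \<in> {a..b}" "x \<notin> E"
proof -
  have "\<not> {a..b} \<subseteq> E"
  proof
    assume "{a..b} \<subseteq> E"
    then have "measure lebesgue {a..b} \<le> measure lebesgue E"
      using assms(1) by (intro measure_mono_fmeasurable) auto
    moreover have "a \<le> b" using assms(2) measure_nonneg[of lebesgue E] by linarith
    ultimately show False using assms(2) by simp
  qed
  then show ?thesis using that by blast
qed

lemma log_plus_max_mod_at_top:
  assumes "transcendental_entire f"
  shows "\<forall>\<^sub>F r in at_top. log_plus (max_mod f r) \<ge> B"
proof -
  have "\<forall>\<^sub>F r in at_top. max_mod f r \<ge> exp B * r ^ 0" by (rule max_mod_ge_power[OF assms])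
  then show ?thesis
  proof eventually_elim
    case (elim r)
    have "B = ln (exp B)" by simp
    also have "\<dots> \<le> log_plus (exp B)" by (rule ln_le_log_plus) simp
    also have "\<dots> \<le> log_plus (max_mod f r)" using elim by (intro log_plus_mono) simp
    finally show ?case .
  qed
qed

lemma eventually_half_at_top:
  assumes "\<forall>\<^sub>F r in at_top. P (r::real)"
  shows "\<forall>\<^sub>F r in at_top. P (r / 2)"
proof -
  have "filterlim (\<lambda>r::real. (1/2) * r) at_top at_top"
    by (rule filterlim_tendsto_pos_mult_at_top[OF tendsto_const]) (auto simp: filterlim_ident)
  then show ?thesis using assms unfolding filterlim_iff by simp
qed

lemma exceeds_small_functions:
  assumes g: "transcendental_entire g" and E: "E \<in> lmeasurable" and I: "finite I"
    and small: "\<And>i. i \<in> I \<Longrightarrow> small_off E (h i) g"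
  shows "\<exists>r\<ge>1. nev_T g r > C * (1 + (\<Sum>i\<in>I. nev_T (h i) r))"
proof -
  have ent: "entire g" using g unfolding transcendental_entire_def by blast
  define C' where "C' = \<bar>C\<bar> + 1"
  \<comment> \<open>The \<open>card I\<close> small terms together then take at most half of
    \<open>nev_T g r\<close> after multiplication by \<open>C'\<close>; the other half absorbs the
    constant \<open>C'\<close>, since 7/3 > 2.\<close>
  define \<epsilon> where "\<epsilon> = 1 / (2 * C' * (card I + 1))"
  have C': "C' \<ge> 1" "C \<le> C'" unfolding C'_def by auto
  have e: "\<epsilon> > 0" unfolding \<epsilon>_def using C' by (intro divide_pos_pos mult_pos_pos) auto
  have ev1: "\<forall>\<^sub>F r in at_top. \<forall>i\<in>I. r \<notin> E \<longrightarrow> nev_T (h i) r \<le> \<epsilon> * nev_T g r"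
    using small e I unfolding small_off_def by (intro eventually_ball_finite) auto
  have ev2: "\<forall>\<^sub>F r in at_top. log_plus (max_mod g (r / 2)) \<ge> 7 * C'"
    by (intro eventually_half_at_top log_plus_max_mod_at_top g)
  have "\<forall>\<^sub>F r in at_top. (\<forall>i\<in>I. r \<notin> E \<longrightarrow> nev_T (h i) r \<le> \<epsilon> * nev_T g r) \<and>
      log_plus (max_mod g (r / 2)) \<ge> 7 * C' \<and> r \<ge> 1"
    using ev1 ev2 eventually_ge_at_top[of 1] by eventually_elim auto
  then obtain x where x: "\<And>r. r \<ge> x \<Longrightarrow> (\<forall>i\<in>I. r \<notin> E \<longrightarrow> nev_T (h i) r \<le> \<epsilon> * nev_T g r) \<and>
      log_plus (max_mod g (r / 2)) \<ge> 7 * C' \<and> r \<ge> 1"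
    unfolding eventually_at_top_linorder by blast
  obtain r where r: "r \<in> {x..x + (measure lebesgue E + 1)}" "r \<notin> E"
    by (rule exists_outside_lmeasurable[OF E, of "x + (measure lebesgue E + 1)" x]) auto
  then have r': "\<And>i. i \<in> I \<Longrightarrow> nev_T (h i) r \<le> \<epsilon> * nev_T g r" "log_plus (max_mod g (r / 2)) \<ge> 7 * C'" "r \<ge> 1"
    using x[of r] by auto
  have T: "nev_T g r > 2 * C'" using log_plus_max_mod_le_nev_T[OF ent, of r] r' C' by simp
  have "(\<Sum>i\<in>I. nev_T (h i) r) \<le> (\<Sum>i\<in>I. \<epsilon> * nev_T g r)" by (intro sum_mono r')
  also have "\<dots> = (real (card I) * \<epsilon>) * nev_T g r" by simp
  also have "\<dots> \<le> 1 / (2 * C') * nev_T g r"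
  proof (rule mult_right_mono)
    have "real (card I) * \<epsilon> = 1 / (2 * C') * (card I / (card I + 1))"
      using C' by (simp add: \<epsilon>_def)
    also have "\<dots> \<le> 1 / (2 * C') * 1" using C' by (intro mult_left_mono) auto
    finally show "real (card I) * \<epsilon> \<le> 1 / (2 * C')" by simp
  qed auto
  finally have "C' * (\<Sum>i\<in>I. nev_T (h i) r) \<le> C' * (1 / (2 * C') * nev_T g r)"
    using C' by (intro mult_left_mono) auto
  also have "\<dots> = nev_T g r / 2" using C' by simp
  finally have "C' * (1 + (\<Sum>i\<in>I. nev_T (h i) r)) < nev_T g r" using T by (simp add: distrib_left)
  moreover have "C * (1 + (\<Sum>i\<in>I. nev_T (h i) r)) \<le> C' * (1 + (\<Sum>i\<in>I. nev_T (h i) r))"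
    using C' by (intro mult_right_mono add_nonneg_nonneg sum_nonneg) auto
  ultimately show ?thesis using r'(3) by (intro exI[of _ r]) auto
qed

text \<open>The logarithmic form of \<open>max_mod_root_le\<close>, a substitute for convexity of
  log M in log r. By \<open>M\<close> the extra factor \<open>y\<close> is at most the maximum
  modulus at \<open>y ^ N\<close>, which accounts for the 2.\<close>

lemma log_plus_max_mod_root_le:
  assumes F: "entire F" and N: "N \<ge> 1" and y: "y > 1" and M: "y ^ N \<le> max_mod F (y ^ N)"
  shows "log_plus (max_mod F y) \<le> ln (max 1 (max_mod F 1)) + 2 * log_plus (max_mod F (y ^ N)) / N"
proof -
  define C where "C = max 1 (max_mod F 1)"
  define \<Lambda> where "\<Lambda> = log_plus (max_mod F (y ^ N))"
  have C: "C \<ge> 1" "ln C \<ge> 0" unfolding C_def by auto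
  have yN: "1 < y ^ N" by (rule one_less_power) (use y N in auto)
  have eL: "max_mod F (y ^ N) = exp \<Lambda>" unfolding \<Lambda>_def log_plus_eq using M yN by simp
  have L0: "\<Lambda> \<ge> 0" unfolding \<Lambda>_def by simp
  have yL: "y \<le> exp \<Lambda>" using M self_le_power[of y N] y N unfolding eL by simp
  have "max_mod F y ^ N \<le> C ^ N * (y * exp \<Lambda>)"
    using max_mod_root_le[OF F N y] L0 unfolding C_def eL by simp
  also have "\<dots> \<le> C ^ N * (exp \<Lambda> * exp \<Lambda>)"
    using C yL by (intro mult_left_mono mult_right_mono) auto
  also have "\<dots> = exp (ln C + 2 * \<Lambda> / N) ^ N"
    using C N by (simp add: exp_add power_mult_distrib exp_of_nat_mult[symmetric] mult_exp_exp)
  finally have "max_mod F y \<le> exp (ln C + 2 * \<Lambda> / N)"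
    using N by (rule_tac power_le_imp_le_base[of _ "N - 1"]) auto
  then show ?thesis using C L0 unfolding C_def[symmetric] \<Lambda>_def[symmetric]
    by (subst log_plus_le_iff) auto
qed

text \<open>In the application \<open>u\<close> runs over all the inner functions and
  \<open>h\<close> over those preceding \<open>g\<close>. At the chosen radius both sums are
  compared with one quantity \<Lambda> = log M(S, F), where S^2 = M(r, g).\<close>

lemma composition_exceeds:
  fixes u :: "'j \<Rightarrow> complex \<Rightarrow> complex" and h :: "'i \<Rightarrow> complex \<Rightarrow> complex"
  assumes F: "transcendental_entire F" and ordF: "nev_order F > 0"
    and g: "transcendental_entire g" and ordg: "nev_order g < \<infinity>"
    and E: "E \<in> lmeasurable" and I: "finite I" and J: "finite J"
    and h: "\<And>i. i \<in> I \<Longrightarrow> entire (h i)" and small: "\<And>i. i \<in> I \<Longrightarrow> small_off E (h i) g"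
    and u: "\<And>j. j \<in> J \<Longrightarrow> nev_order (u j) < \<infinity>"
  shows "\<exists>r\<ge>1. nev_T (F \<circ> g) r > C * (1 + ((\<Sum>j\<in>J. nev_T (u j) r) + (\<Sum>i\<in>I. nev_T (F \<circ> h i) r)))"
proof -
  have entF: "entire F" and entg: "entire g" using F g unfolding transcendental_entire_def by auto
  define L where "L = (\<lambda>r. log_plus (max_mod g r))"
  define c where "c = bohr_const"
  have c: "c > 0" unfolding c_def by (rule bohr_const_pos)
  define p q where "p = real (card J)" and "q = real (card I)"
  define C' where "C' = \<bar>C\<bar> + 1"
  have C': "C' \<ge> 1" "C \<le> C'" unfolding C'_def by auto
  define C0 where "C0 = max 1 (max_mod F 1)"
  obtain \<delta> where d: "\<delta> > 0" "\<And>x. \<exists>R\<ge>x. R powr \<delta> \<le> log_plus (max_mod F R)"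
    by (rule positive_order_bound[OF ordF entF]) blast
  obtain \<rho>g :: nat where rg: "\<forall>\<^sub>F r in at_top. nev_T g r \<le> r ^ \<rho>g" by (rule finite_order_bound[OF ordg])
  have "\<forall>j. \<exists>k::nat. j \<in> J \<longrightarrow> (\<forall>\<^sub>F r in at_top. nev_T (u j) r \<le> r ^ k)"
    using u finite_order_bound by metis
  then obtain k :: "'j \<Rightarrow> nat" where k: "\<And>j. j \<in> J \<Longrightarrow> \<forall>\<^sub>F r in at_top. nev_T (u j) r \<le> r ^ k j" by metis
  \<comment> \<open>One exponent for all functions; the summand 1 absorbs the constant
    \<open>3 * 2 ^ \<rho>g\<close> lost in passing from the characteristic to
    \<open>L\<close>.\<close>
  define \<rho> where "\<rho> = \<rho>g + 1 + (\<Sum>j\<in>J. k j)"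
  have evL: "\<forall>\<^sub>F r in at_top. L r \<le> r ^ \<rho>"
  proof -
    have "filterlim (\<lambda>r::real. 2 * r) at_top at_top"
      by (rule filterlim_tendsto_pos_mult_at_top[OF tendsto_const]) (auto simp: filterlim_ident)
    then have "\<forall>\<^sub>F r in at_top. nev_T g (2 * r) \<le> (2 * r) ^ \<rho>g" using rg unfolding filterlim_iff by blast
    then show ?thesis using eventually_ge_at_top[of "3 * 2 ^ \<rho>g"] eventually_ge_at_top[of 1]
    proof eventually_elim
      case (elim r)
      have "L r \<le> 3 * nev_T g (2 * r)"
        using log_plus_max_mod_le_nev_T[OF entg, of "2 * r"] elim unfolding L_def by simp
      also have "\<dots> \<le> (3 * 2 ^ \<rho>g) * r ^ \<rho>g" using elim by (simp add: power_mult_distrib)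
      also have "\<dots> \<le> r * r ^ \<rho>g" using elim by (intro mult_right_mono) auto
      also have "\<dots> = r ^ (\<rho>g + 1)" by simp
      also have "\<dots> \<le> r ^ \<rho>" using elim unfolding \<rho>_def by (intro power_increasing) auto
      finally show ?case .
    qed
  qed
  have evu: "\<forall>\<^sub>F r in at_top. \<forall>j\<in>J. nev_T (u j) r \<le> r ^ \<rho>"
  proof (intro eventually_ball_finite J ballI)
    fix j assume j: "j \<in> J"
    have "k j \<le> \<rho>" unfolding \<rho>_def using member_le_sum[of j J k] J j by simp
    then have *: "r ^ k j \<le> r ^ \<rho>" if "r \<ge> 1" for r :: real using that by (intro power_increasing) auto
    show "\<forall>\<^sub>F r in at_top. nev_T (u j) r \<le> r ^ \<rho>"
      using k[OF j] eventually_ge_at_top[of 1] by eventually_elim (meson order_trans *)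
  qed
  obtain N :: nat where N: "real N \<ge> 48 * C' * q" "N \<ge> 1"
  proof -
    obtain n :: nat where "real n \<ge> max 1 (48 * C' * q)" using real_arch_simple by blast
    then show ?thesis using that[of n] by auto
  qed
  \<comment> \<open>Makes R = s^N' so large that R^\<delta> \<ge> s^(2\<rho>+1), one power of
    \<open>s\<close> above the growth of the \<open>u j\<close> at radii up to 8 s^2.\<close>
  obtain N' :: nat where N': "real N' * \<delta> \<ge> 2 * real \<rho> + 1" "N' \<ge> 1"
  proof -
    obtain n :: nat where "real n \<ge> (2 * real \<rho> + 1) / \<delta>" using real_arch_simple by blast
    then have n: "real n * \<delta> \<ge> 2 * real \<rho> + 1" using d by (simp add: divide_le_eq)
    then have "n \<ge> 1" by (cases n) auto
    then show ?thesis using that n by blast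
  qed
  define K :: real where "K = 32 ^ (4 * \<rho> + 1)"
  \<comment> \<open>Chosen with 3 \<epsilon> K = 1/(2N), so that M(T, h i) will be at most the 2N-th
    root of M(r, g).\<close>
  define \<epsilon> where "\<epsilon> = 1 / (6 * K * N)"
  have K: "K > 0" unfolding K_def by simp
  have e: "\<epsilon> > 0" unfolding \<epsilon>_def using K N by (intro divide_pos_pos mult_pos_pos) auto
  have ev1: "\<forall>\<^sub>F r in at_top. \<forall>i\<in>I. r \<notin> E \<longrightarrow> nev_T (h i) r \<le> \<epsilon> * nev_T g r"
    using small e I unfolding small_off_def by (intro eventually_ball_finite) auto
  have ev2: "\<forall>\<^sub>F r in at_top. max_mod F r \<ge> r"
    using max_mod_ge_power[OF F, of 1 1] by simp
  \<comment> \<open>The exponent \<open>2 * N'\<close> yields sqrt M \<ge> r^N' \<ge> R. The next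
    bound provides sqrt M \<le> c M, the condition on \<open>g 0\<close> in the covering lemma, and
    \<open>L \<ge> 1\<close>.\<close>
  have ev3: "\<forall>\<^sub>F r in at_top. max_mod g r \<ge> 1 * r ^ (2 * N')" by (rule max_mod_ge_power[OF g])
  have ev4: "\<forall>\<^sub>F r in at_top. max_mod g r \<ge> max (1 / c\<^sup>2) (max (cmod (g 0) / c) (exp 1)) * r ^ 0"
    by (rule max_mod_ge_power[OF g])
  have "\<forall>\<^sub>F r in at_top. L r \<le> r ^ \<rho> \<and> (\<forall>j\<in>J. nev_T (u j) r \<le> r ^ \<rho>) \<and>
      (\<forall>i\<in>I. r \<notin> E \<longrightarrow> nev_T (h i) r \<le> \<epsilon> * nev_T g r) \<and> max_mod F r \<ge> r \<and>
      max_mod g r \<ge> r ^ (2 * N') \<and> max_mod g r \<ge> 1 / c\<^sup>2 \<and> max_mod g r \<ge> cmod (g 0) / c \<and>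
      max_mod g r \<ge> exp 1"
    using evL evu ev1 ev2 ev3 ev4 by eventually_elim auto
  then obtain x1 where x1: "\<And>r. r \<ge> x1 \<Longrightarrow> L r \<le> r ^ \<rho> \<and> (\<forall>j\<in>J. nev_T (u j) r \<le> r ^ \<rho>) \<and>
      (\<forall>i\<in>I. r \<notin> E \<longrightarrow> nev_T (h i) r \<le> \<epsilon> * nev_T g r) \<and> max_mod F r \<ge> r \<and>
      max_mod g r \<ge> r ^ (2 * N') \<and> max_mod g r \<ge> 1 / c\<^sup>2 \<and> max_mod g r \<ge> cmod (g 0) / c \<and>
      max_mod g r \<ge> exp 1"
    unfolding eventually_at_top_linorder by blast
  define s0 where "s0 = Max {x1, 32, 12 * C' * (1 + p * 8 ^ \<rho>), 24 * C' * q * ln C0, measure lebesgue E}"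
  have s0: "x1 \<le> s0" "32 \<le> s0" "12 * C' * (1 + p * 8 ^ \<rho>) \<le> s0" "24 * C' * q * ln C0 \<le> s0"
      "measure lebesgue E \<le> s0"
    unfolding s0_def by (auto intro!: Max_ge)
  obtain R where R: "R \<ge> s0 ^ N'" "R powr \<delta> \<le> log_plus (max_mod F R)" using d(2) by blast
  \<comment> \<open>\<open>R\<close> comes first, because \<open>F\<close> is known to be large only
    at special radii; the range of admissible \<open>r\<close> is then fitted to it.\<close>
  define s where "s = root N' R"
  have "s0 ^ N' > 0" using s0 by simp
  then have R0: "R > 0" using R by linarith
  have sN': "s ^ N' = R" unfolding s_def using N' R0 by simp
  have "root N' (s0 ^ N') \<le> root N' R" using N' R by (intro real_root_le_mono) auto
  then have ss: "s0 \<le> s" unfolding s_def using N' s0 by (simp add: real_root_power_cancel)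
  have s32: "s \<ge> 32" using ss s0 by linarith
  obtain r where r: "s \<le> r" "r \<le> s\<^sup>2" "L (32 * r) \<le> K * L r"
    unfolding K_def
  proof (rule doubling_radius[of s L \<rho>])
    show "L r \<le> r ^ \<rho>" if "r \<ge> s" for r using x1[of r] that ss s0 by linarith
    have "ln (exp 1) \<le> log_plus (exp 1)" by (rule ln_le_log_plus) simp
    also have "\<dots> \<le> L s" unfolding L_def using x1[of s] ss s0 by (intro log_plus_mono) auto
    finally show "L s \<ge> 1" by simp
  qed (use s32 in auto)
  have r32: "r \<ge> 32" and rx: "r \<ge> x1" using r s32 ss s0 by auto
  note at_r = x1[OF rx]
  define M where "M = max_mod g r"
  have M: "M \<ge> exp 1" "M \<ge> 1 / c\<^sup>2" "M \<ge> cmod (g 0) / c" "M \<ge> r ^ (2 * N')" using at_r unfolding M_def by auto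
  have M1: "M > 1" using M(1) exp_ge_add_one_self[of "1::real"] by linarith
  have eL: "M = exp (L r)" unfolding L_def log_plus_eq M_def[symmetric] using M1 by simp
  define y where "y = exp (L r / (2 * N))"
  define S where "S = y ^ N"
  have "S = exp (L r / 2)" unfolding S_def y_def using N by (simp add: exp_of_nat_mult[symmetric])
  then have "S\<^sup>2 = M" "S \<ge> 0" unfolding eL by (simp_all add: exp_double[symmetric])
  then have S: "S = sqrt M" using real_sqrt_unique by metis
  have Lpos: "L r > 0" using eL M1 by (metis one_less_exp_iff)
  have y1: "y > 1" unfolding y_def using Lpos N by simp
  have RS: "R \<le> S"
  proof -
    have "R = s ^ N'" using sN' by simp
    also have "\<dots> \<le> r ^ N'" using r s32 by (intro power_mono) auto
    also have "\<dots> \<le> S" unfolding S using M(4) by (intro real_le_rsqrt) (simp add: power_mult[symmetric] mult.commute)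
    finally show ?thesis .
  qed
  have S1: "S \<ge> x1"
  proof -
    have "s0 ^ 1 \<le> s0 ^ N'" using s0 N' by (intro power_increasing) auto
    then show ?thesis using RS R s0 by simp
  qed
  have ScM: "S \<le> c * M"
  proof -
    have "1 / c = sqrt (1 / c\<^sup>2)" using c by (simp add: real_sqrt_divide)
    also have "\<dots> \<le> sqrt M" using M by (intro real_sqrt_le_mono) auto
    finally have "1 \<le> c * sqrt M" using c by (simp add: field_simps)
    then have "1 * sqrt M \<le> (c * sqrt M) * sqrt M" using M1 by (intro mult_right_mono) auto
    then show ?thesis unfolding S using M1 by (simp add: mult.assoc)
  qed
  define \<Lambda> where "\<Lambda> = log_plus (max_mod F S)"
  have Lam: "\<Lambda> \<ge> s ^ (2 * \<rho> + 1)"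
  proof -
    have "s ^ (2 * \<rho> + 1) = s powr (2 * real \<rho> + 1)"
      using s32 powr_realpow[of s "2 * \<rho> + 1"] by (simp add: add.commute)
    also have "\<dots> \<le> s powr (real N' * \<delta>)" using N' s32 by (intro powr_mono) auto
    also have "\<dots> = (s powr real N') powr \<delta>" by (simp add: powr_powr)
    also have "\<dots> = R powr \<delta>" using sN' s32 by (simp add: powr_realpow)
    also have "\<dots> \<le> log_plus (max_mod F R)" by (rule R)
    also have "\<dots> \<le> \<Lambda>" unfolding \<Lambda>_def
      by (intro log_plus_mono max_mod_mono entF RS) (use R0 in auto)
    finally show ?thesis .
  qed
  have s_le: "s \<le> s ^ (2 * \<rho> + 1)" using s32 by (intro self_le_power) auto
  have Lpos2: "\<Lambda> > 0" "s \<le> \<Lambda>" using Lam s_le s32 by linarith+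
  \<comment> \<open>The radius compared is \<open>T = t / 2\<close>:
    \<open>T / 2 \<ge> 2 * r\<close> serves the covering bound, \<open>t = 2 * T\<close> avoids
    \<open>E\<close>, and \<open>t \<le> 32 * r\<close> allows the doubling bound. The interval has
    length \<open>8 * r\<close>, more than the measure of \<open>E\<close>.\<close>
  obtain t where t: "t \<in> {8 * r..16 * r}" "t \<notin> E"
    by (rule exists_outside_lmeasurable[OF E, of "16 * r" "8 * r"]) (use r s32 ss s0 in auto)
  define T where "T = t / 2"
  have T: "4 * r \<le> T" "T \<le> 8 * r" unfolding T_def using t by auto
  have Tx: "T \<ge> x1" "t \<ge> x1" "T \<ge> 1" "T > 0" using T rx r32 unfolding T_def by auto
  have lower: "\<Lambda> \<le> 3 * nev_T (F \<circ> g) T"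
  proof -
    have "\<Lambda> \<le> log_plus (max_mod F (c * M))" unfolding \<Lambda>_def
      by (intro log_plus_mono max_mod_mono entF ScM) (use R0 RS in auto)
    also have "\<dots> \<le> log_plus (max_mod (F \<circ> g) (2 * r))"
      unfolding c_def M_def
      by (intro log_plus_mono max_mod_compose_ge entF entg)
         (use M M1 r32 c in \<open>auto simp: c_def M_def field_simps\<close>)
    also have "\<dots> \<le> log_plus (max_mod (F \<circ> g) (T / 2))"
      by (intro log_plus_mono max_mod_mono entire_compose entF entg) (use T r32 in auto)
    also have "\<dots> \<le> 3 * nev_T (F \<circ> g) T"
      by (intro log_plus_max_mod_le_nev_T entire_compose entF entg Tx)
    finally show ?thesis .
  qed
  have upper_u: "12 * C' * (1 + (\<Sum>j\<in>J. nev_T (u j) T)) \<le> \<Lambda>"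
  proof -
    have "nev_T (u j) T \<le> 8 ^ \<rho> * s ^ (2 * \<rho>)" if "j \<in> J" for j
    proof -
      have "nev_T (u j) T \<le> T ^ \<rho>" using x1[OF Tx(1)] that by blast
      also have "\<dots> \<le> (8 * s\<^sup>2) ^ \<rho>" using T r Tx by (intro power_mono) auto
      also have "\<dots> = 8 ^ \<rho> * s ^ (2 * \<rho>)" by (simp add: power_mult_distrib power_mult[symmetric])
      finally show ?thesis .
    qed
    then have "(\<Sum>j\<in>J. nev_T (u j) T) \<le> p * (8 ^ \<rho> * s ^ (2 * \<rho>))"
      unfolding p_def by (rule sum_bounded_above)
    moreover have "1 \<le> s ^ (2 * \<rho>)" using s32 by (intro one_le_power) auto
    ultimately have "1 + (\<Sum>j\<in>J. nev_T (u j) T) \<le> (1 + p * 8 ^ \<rho>) * s ^ (2 * \<rho>)"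
      by (simp add: algebra_simps)
    then have "12 * C' * (1 + (\<Sum>j\<in>J. nev_T (u j) T)) \<le> 12 * C' * ((1 + p * 8 ^ \<rho>) * s ^ (2 * \<rho>))"
      using C' by (intro mult_left_mono) auto
    also have "\<dots> = (12 * C' * (1 + p * 8 ^ \<rho>)) * s ^ (2 * \<rho>)" by (simp only: mult.assoc)
    also have "\<dots> \<le> s * s ^ (2 * \<rho>)" using s0 ss s32 by (intro mult_right_mono) auto
    also have "\<dots> = s ^ (2 * \<rho> + 1)" by simp
    finally show ?thesis using Lam by linarith
  qed
  \<comment> \<open>The factor 3 \<epsilon> K gives M(T, h i) \<le> y with y^N = S, so the root
    inequality leaves only the fraction 2/N of \<Lambda>; \<open>N\<close> was chosen to make the
    sum of these small.\<close>
  have upper_h: "12 * C' * (\<Sum>i\<in>I. nev_T (F \<circ> h i) T) \<le> \<Lambda>"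
  proof -
    have "nev_T (F \<circ> h i) T \<le> ln C0 + 2 * \<Lambda> / N" if i: "i \<in> I" for i
    proof -
      have "log_plus (max_mod (h i) T) \<le> 3 * nev_T (h i) t"
        using log_plus_max_mod_le_nev_T[OF h[OF i], of t] Tx unfolding T_def by simp
      also have "\<dots> \<le> 3 * (\<epsilon> * nev_T g t)" using x1[OF Tx(2)] i t by simp
      also have "\<dots> \<le> 3 * (\<epsilon> * L (32 * r))"
      proof -
        have "nev_T g t \<le> L t" unfolding L_def by (rule nev_T_le_log_plus_max_mod[OF entg]) (use t r32 in auto)
        also have "\<dots> \<le> L (32 * r)" unfolding L_def
          by (intro log_plus_mono max_mod_mono entg) (use t r32 in auto)
        finally show ?thesis using e by simp
      qed
      also have "\<dots> \<le> 3 * (\<epsilon> * (K * L r))" using r(3) e by simp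
      also have "\<dots> = L r / (2 * N)" unfolding \<epsilon>_def using K N by simp
      finally have hy: "max_mod (h i) T \<le> y"
        unfolding y_def using Lpos N by (subst (asm) log_plus_le_iff) auto
      have "nev_T (F \<circ> h i) T \<le> log_plus (max_mod (F \<circ> h i) T)"
        by (intro nev_T_le_log_plus_max_mod entire_compose entF h i) (use Tx in auto)
      also have "\<dots> \<le> log_plus (max_mod F (max_mod (h i) T))"
        by (intro log_plus_mono max_mod_compose_le entF h i) (use Tx in auto)
      also have "\<dots> \<le> log_plus (max_mod F y)"
        by (intro log_plus_mono max_mod_mono entF hy max_mod_nonneg h i) (use Tx in auto)
      also have "\<dots> \<le> ln C0 + 2 * \<Lambda> / N"
        unfolding C0_def \<Lambda>_def S_def
        by (rule log_plus_max_mod_root_le[OF entF N(2) y1]) (use x1[OF S1] in \<open>auto simp: S_def\<close>)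
      finally show ?thesis .
    qed
    then have "(\<Sum>i\<in>I. nev_T (F \<circ> h i) T) \<le> q * (ln C0 + 2 * \<Lambda> / N)"
      unfolding q_def by (rule sum_bounded_above)
    then have "24 * C' * (\<Sum>i\<in>I. nev_T (F \<circ> h i) T) \<le> 24 * C' * (q * (ln C0 + 2 * \<Lambda> / N))"
      using C' by (intro mult_left_mono) auto
    also have "\<dots> = 24 * C' * q * ln C0 + (48 * C' * q) * (\<Lambda> / N)" by (simp add: algebra_simps)
    also have "\<dots> \<le> \<Lambda> + N * (\<Lambda> / N)"
      by (intro add_mono mult_right_mono) (use s0 ss Lpos2 N in auto)
    also have "\<dots> = 2 * \<Lambda>" using N by simp
    finally show ?thesis by simp
  qed
  let ?X = "1 + ((\<Sum>j\<in>J. nev_T (u j) T) + (\<Sum>i\<in>I. nev_T (F \<circ> h i) T))"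
  have "C * ?X \<le> C' * ?X" using C' by (intro mult_right_mono add_nonneg_nonneg sum_nonneg) auto
  \<comment> \<open>The two upper bounds contribute at most \<Lambda>/12 each, against the lower
    bound \<Lambda>/3.\<close>
  also have "C' * ?X < nev_T (F \<circ> g) T"
    using upper_u upper_h lower Lpos2(1) by (simp add: distrib_left)
  finally show ?thesis using Tx(3) by blast
qed

text \<open>The finitely many exceptional sets of neighbouring pairs are united into one of finite
  measure, outside of which transitivity applies.\<close>

lemma small_wrt_chain:
  fixes f :: "nat \<Rightarrow> complex \<Rightarrow> complex"
  assumes small: "\<And>i. i \<in> {1..n-1} \<Longrightarrow> small_wrt (nev_T (f i)) (f (i+1))"
  obtains E where "E \<in> lmeasurable" "\<And>i j. 1 \<le> i \<Longrightarrow> i < j \<Longrightarrow> j \<le> n \<Longrightarrow> small_off E (f i) (f j)"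
proof -
  have "\<forall>i. \<exists>E. i \<in> {1..n-1} \<longrightarrow> E \<in> lmeasurable \<and> small_off E (f i) (f (i+1))"
    using small small_wrt_imp_small_off by metis
  then obtain E where E: "\<And>i. i \<in> {1..n-1} \<Longrightarrow> E i \<in> lmeasurable"
      "\<And>i. i \<in> {1..n-1} \<Longrightarrow> small_off (E i) (f i) (f (i+1))" by metis
  define E' where "E' = (\<Union>i\<in>{1..n-1}. E i)"
  have step: "small_off E' (f i) (f (i+1))" if "i \<in> {1..n-1}" for i
    by (rule small_off_subset[OF E(2)[OF that]]) (use that in \<open>auto simp: E'_def\<close>)
  have "small_off E' (f i) (f j)" if i: "1 \<le> i" and ij: "i < j" and j: "j \<le> n" for i j
    using ij j
  proof (induction j)
    case (Suc j)
    have last: "small_off E' (f j) (f (Suc j))" using step[of j] Suc.prems i by simp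
    show ?case
    proof (cases "i = j")
      case False
      then show ?thesis using small_off_trans[OF Suc.IH last] Suc.prems by simp
    qed (use last in simp)
  qed simp
  moreover have "E' \<in> lmeasurable" unfolding E'_def using E(1) by (intro fmeasurable.finite_UN) auto
  ultimately show ?thesis using that by blast
qed

theorem mainTheorem2:
  fixes n :: nat and f :: "nat \<Rightarrow> complex \<Rightarrow> complex" and F :: "complex \<Rightarrow> complex"
  assumes "n \<ge> 1"
    and "\<And>i. i \<in> {1..n} \<Longrightarrow> transcendental_entire (f i)"
    and "\<And>i. i \<in> {1..n} \<Longrightarrow> nev_order (f i) < \<infinity>"
    and "\<And>i. i \<in> {1..n-1} \<Longrightarrow> small_wrt (nev_T (f i)) (f (i+1))"
    and "transcendental_entire F"
    and "nev_order F > 0"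
  shows "trdeg (2*n) (\<lambda>j. if j < n then f (j+1) else F \<circ> f (j - n + 1)) = enat (2*n)"
proof (rule trdeg_eq_of_alg_indep)
  define g where "g = (\<lambda>j. if j < n then f (j+1) else F \<circ> f (j - n + 1))"
  obtain E where E: "E \<in> lmeasurable"
      "\<And>i j. 1 \<le> i \<Longrightarrow> i < j \<Longrightarrow> j \<le> n \<Longrightarrow> small_off E (f i) (f j)"
    using small_wrt_chain[of n f] assms(4) by blast
  have entF: "entire F" using assms(5) unfolding transcendental_entire_def by blast
  have entf: "entire (f i)" if "i \<in> {1..n}" for i
    using assms(2)[OF that] unfolding transcendental_entire_def by blast
  have entg: "entire (g j)" if "j < 2 * n" for j
    unfolding g_def using that by (auto intro!: entire_compose entF entf)
  \<comment> \<open>The functions are adjoined one at a time, all inner functions first, then the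
    compositions in the same order.\<close>
  have "k \<le> 2 * n \<Longrightarrow> alg_indep k g" for k
  proof (induction k)
    case (Suc k)
    show ?case
    proof (rule alg_indep_Suc)
      show "alg_indep k g" using Suc by simp
      show "entire (g i)" if "i \<le> k" for i using that Suc.prems by (intro entg) simp
      fix C :: real
      show "\<exists>r\<ge>1. nev_T (g k) r > C * (1 + (\<Sum>i<k. nev_T (g i) r))"
      proof (cases "k < n")
        case True
        have "\<exists>r\<ge>1. nev_T (f (k+1)) r > C * (1 + (\<Sum>i<k. nev_T (f (i+1)) r))"
          by (rule exceeds_small_functions[OF _ E(1)]) (use True assms(2) E(2) in auto)
        then show ?thesis using True by (simp add: g_def)
      next
        case False
        \<comment> \<open>The new function is \<open>F \<circ> f (l + 1)\<close>. Its predecessors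
          are all \<open>n\<close> inner functions, controlled by finite order, and \<open>l\<close>
          compositions, whose inner functions are small with respect to
          \<open>f (l + 1)\<close>.\<close>
        define l where "l = k - n"
        have k: "k = n + l" and l: "l < n" using False Suc.prems by (auto simp: l_def)
        have "\<exists>r\<ge>1. nev_T (F \<circ> f (l+1)) r >
          C * (1 + ((\<Sum>j<n. nev_T (f (j+1)) r) + (\<Sum>i<l. nev_T (F \<circ> f (i+1)) r)))"
          by (rule composition_exceeds[OF assms(5,6) _ _ E(1)]) (use l assms(2,3) entf E(2) in auto)
        moreover have "(\<Sum>i<k. nev_T (g i) r) =
          (\<Sum>j<n. nev_T (f (j+1)) r) + (\<Sum>i<l. nev_T (F \<circ> f (i+1)) r)" for r
        proof -
          have "(\<Sum>i<n + l. a i) = (\<Sum>j<n. a j) + (\<Sum>i<l. a (n + i))" for a :: "nat \<Rightarrow> real"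
            by (induction l) (auto simp: add.assoc)
          then show ?thesis unfolding k by (simp add: g_def)
        qed
        ultimately show ?thesis using k by (simp add: g_def)
      qed
    qed
  qed (rule alg_indep_0)
  then show "alg_indep (2*n) (\<lambda>j. if j < n then f (j+1) else F \<circ> f (j - n + 1))"
    unfolding g_def by blast
qed

end
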